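(* Consider the aggregation models defined in the context, and denote the optimal value of each model by the name of the model. Then: (i) In general, $\text{Envelope}\le\text{Rectangular}\le\text{Multistage}\le\text{Two-Stage}\le\text{Outer}$. (ii) Under convex ESS constraints, $\text{Envelope}\le\text{Rectangular}\le\text{Multistage}=\text{Enumeration}\le\text{Two-Stage}\le\text{Outer}$. (iii) When there is only one ESS ($|S_S|=1$), $\text{Envelope}\le\text{Single-ESS}=\text{Rectangular}=\text{Multistage}\le\text{Two-Stage}\le\text{Outer}$. (iv) When there is no ESS ($S_S=\emptyset$), $\text{Envelope}=\text{Rectangular}=\text{Multistage}=\text{Enumeration}=\text{Two-Stage}=\text{Outer}$.
   Context: **Distribution system.** $T\ge 1$ is an integer, $S_T=\{1,\dots,T\}$, $\tau>0$. $S_N$ is a finite set of nodes containing node $1$; $S_D,S_G,S_S\subseteq S_N$ are the sets of loads, generators and energy storage systems (ESSs). For each period $t$ the variables are $p_t^A\in\mathbb{R}$ (aggregate power), $p_t^S=(p_{it}^S)_{i\in S_S}$ (ESS active power), $e_t^S=(e_{it}^S)_{i\in S_S}$ (stored energy), and $y_t=(p_{it}^D,q_{it}^D,p_{it}^G,q_{it}^G,q_{it}^S,p_{it}^N,q_{it}^N)_{i\in S_N}$; quantities of a device type not present at node $i$ are $0$. Real data are given: $\underline P_{it}^D,\overline P_{it}^D,\eta_{it}^D,\underline P_{it}^G,\overline P_{it}^G,\overline S_{it}^G,\overline S_i^S,\underline E_i^S,\overline E_i^S$, with $\overline P_i^{SD},\overline P_i^{SC}>0$, $\kappa_i^S,\eta_i^{SD},\eta_i^{SC}\in(0,1]$,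 a convex set $C_N$, and a given initial stored energy $e_0^S=(e_{i0}^S)_{i\in S_S}$ with $\underline E_i^S\le e_{i0}^S\le\overline E_i^S$ for all $i$. **The set $C_t$.** $C_t$ is the set of $(p_t^A,p_t^S,y_t)$ with: $\underline P_{it}^D\le p_{it}^D\le\overline P_{it}^D$ and $q_{it}^D=\eta_{it}^Dp_{it}^D$ for $i\in S_D$; $\underline P_{it}^G\le p_{it}^G\le\overline P_{it}^G$ and $(p_{it}^G)^2+(q_{it}^G)^2\le(\overline S_{it}^G)^2$ for $i\in S_G$; $-\overline P_i^{SC}\le p_{it}^S\le\overline P_i^{SD}$ and $(p_{it}^S)^2+(q_{it}^S)^2\le(\overline S_i^S)^2$ for $i\in S_S$; $p_{it}^N=p_{it}^G+p_{it}^S-p_{it}^D$ and $q_{it}^N=q_{it}^G+q_{it}^S-q_{it}^D$ for $i\in S_N$; $p_t^A=p_{1t}^N$; $((p_{it}^N)_{i\in S_N},(q_{it}^N)_{i\in S_N})\in C_N$. It is assumed that $C_t$ is convex and closed. **General ESS constraints.** Let $F_i(p)=\max\{p,0\}\tau/\eta_i^{SD}+\min\{p,0\}\tau\eta_i^{SC}$. The operational constraints $(\mathrm{OC}_t)$ are: $(p_t^A,p_t^S,y_t)\in C_t$; $e_{it}^S=\kappa_i^Se_{i(t-1)}^S-F_i(p_{it}^S)$ and $\underline E_i^S\le e_{it}^S\le\overline E_i^S$ for all $i\in S_S$. **Convex ESS constraints.** Let $p_t^{SD}=(p_{it}^{SD})_{i\in S_S}$ and $p_t^{SC}=(p_{it}^{SC})_{i\in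 S_S}$ (discharging and charging power). $C_t'$ is the set (assumed convex and closed) of $(p_t^A,p_t^{SD},p_t^{SC},y_t)$ satisfying, with $p_{it}^S:=p_{it}^{SD}-p_{it}^{SC}$, all the constraints listed for $C_t$ except that $-\overline P_i^{SC}\le p_{it}^S\le\overline P_i^{SD}$ is replaced by $0\le p_{it}^{SD}\le\overline P_i^{SD}$, $0\le p_{it}^{SC}\le\overline P_i^{SC}$, $p_{it}^{SD}/\overline P_i^{SD}+p_{it}^{SC}/\overline P_i^{SC}\le1$. The operational constraints $(\mathrm{OC}'_t)$ are: $(p_t^A,p_t^{SD},p_t^{SC},y_t)\in C_t'$; $e_{it}^S=\kappa_i^Se_{i(t-1)}^S-p_{it}^{SD}\tau/\eta_i^{SD}+p_{it}^{SC}\tau\eta_i^{SC}$ and $\underline E_i^S\le e_{it}^S\le\overline E_i^S$ for all $i\in S_S$. **Objective and optimal value.** Let $\phi:\mathbb{R}^T\times\mathbb{R}^T\to\mathbb{R}$ be a function. Every model maximizes $\phi(p^{A\vee},p^{A\wedge})$ over $p^{A\vee},p^{A\wedge}\in\mathbb{R}^T$ (and possibly further variables) subject to $p_t^{A\vee}\le p_t^{A\wedge}$ for all $t\in S_T$ and the constraints below. The optimal value is the supremum of $\phi$ over the feasible set, in $[-\infty,\infty]$. **Models under general ESS constraints.** *Two-Stage:* for all $p^A\in\prod_{t\in S_T}[p_t^{A\vee},p_t^{A\wedge}]$ there exist $(e_t^S,p_t^S,y_t)_{t\in S_T}$ such that $(\mathrm{OC}_t)$ holds for all $t\in S_T$.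 *Multistage:* $\forall p_1^A\in[p_1^{A\vee},p_1^{A\wedge}]\ \exists e_1^S,p_1^S,y_1\ \forall p_2^A\in[p_2^{A\vee},p_2^{A\wedge}]\ \exists e_2^S,p_2^S,y_2\ \cdots\ \forall p_T^A\in[p_T^{A\vee},p_T^{A\wedge}]\ \exists e_T^S,p_T^S,y_T$ such that $(\mathrm{OC}_t)$ holds for all $t\in S_T$. *Rectangular:* additional variables $e_{it}^{S\downarrow},e_{it}^{S\uparrow}$ ($i\in S_S$, $t\in S_T\cup\{0\}$) with $e_{i0}^{S\downarrow}\le e_{i0}^S\le e_{i0}^{S\uparrow}$ and $\underline E_i^S\le e_{it}^{S\downarrow}\le e_{it}^{S\uparrow}\le\overline E_i^S$; and for all $t\in S_T$ and all $e_{t-1}^S\in\prod_{i\in S_S}[e_{i(t-1)}^{S\downarrow},e_{i(t-1)}^{S\uparrow}]$ there exist $e_t^{S\vee},p_t^{S\vee},y_t^\vee,e_t^{S\wedge},p_t^{S\wedge},y_t^\wedge$ with $(p_t^{A\vee},p_t^{S\vee},y_t^\vee),(p_t^{A\wedge},p_t^{S\wedge},y_t^\wedge)\in C_t$ and, for all $i\in S_S$, $e_{it}^{S\vee},e_{it}^{S\wedge}\in[e_{it}^{S\downarrow},e_{it}^{S\uparrow}]$, $e_{it}^{S\vee}=\kappa_i^Se_{i(t-1)}^S-F_i(p_{it}^{S\vee})$, $e_{it}^{S\wedge}=\kappa_i^Se_{i(t-1)}^S-F_i(p_{it}^{S\wedge})$. *Single-ESS* (when $|S_S|=1$, ESS index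 omitted): additional variables $e_t^{S\downarrow},e_t^{S\uparrow}$ ($t\in S_T\cup\{0\}$) with $e_0^{S\downarrow}\le e_0^S\le e_0^{S\uparrow}$, $\underline E^S\le e_t^{S\downarrow}\le e_t^{S\uparrow}\le\overline E^S$, and, for all $t\in S_T$, variables $p_t^{S\vee\downarrow},y_t^{\vee\downarrow},p_t^{S\vee\uparrow},y_t^{\vee\uparrow},p_t^{S\wedge\downarrow},y_t^{\wedge\downarrow},p_t^{S\wedge\uparrow},y_t^{\wedge\uparrow}$ such that for each $\star\in\{\vee,\wedge\}$ and $\bullet\in\{\downarrow,\uparrow\}$: $(p_t^{A\star},p_t^{S\star\bullet},y_t^{\star\bullet})\in C_t$ and $e_t^{S\downarrow}\le\kappa^Se_{t-1}^{S\bullet}-F(p_t^{S\star\bullet})\le e_t^{S\uparrow}$. *Envelope:* additional variables $p_t^{S\vee},y_t^\vee,p_t^{S\wedge},y_t^\wedge,p_t^{S\downarrow},p_t^{S\uparrow}$ ($t\in S_T$) and $e_t^{S\downarrow},e_t^{S\uparrow}$ ($t\in S_T\cup\{0\}$) with $e_{i0}^{S\downarrow}=e_{i0}^{S\uparrow}=e_{i0}^S$ and, for all $i\in S_S$, $t\in S_T$: $e_{it}^{S\uparrow}=\kappa_i^Se_{i(t-1)}^{S\uparrow}-F_i(p_{it}^{S\downarrow})$, $e_{it}^{S\downarrow}=\kappa_i^Se_{i(t-1)}^{S\downarrow}-F_i(p_{it}^{S\uparrow})$, $(p_t^{A\vee},p_t^{S\vee},y_t^\vee),(p_t^{A\wedge},p_t^{S\wedge},y_t^\wedge)\in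 C_t$, $p_{it}^{S\downarrow}\le p_{it}^{S\vee}\le p_{it}^{S\uparrow}$, $p_{it}^{S\downarrow}\le p_{it}^{S\wedge}\le p_{it}^{S\uparrow}$, $e_{it}^{S\downarrow},e_{it}^{S\uparrow}\in[\underline E_i^S,\overline E_i^S]$. *Outer:* additional variables $p_t^{S\vee},y_t^\vee,p_t^{S\wedge},y_t^\wedge$ ($t\in S_T$) with $(p_t^{A\vee},p_t^{S\vee},y_t^\vee),(p_t^{A\wedge},p_t^{S\wedge},y_t^\wedge)\in C_t$, and, with $e_{i0}^{S\vee}=e_{i0}^{S\wedge}=e_{i0}^S$, $e_{it}^{S\vee}=\kappa_i^Se_{i(t-1)}^{S\vee}-F_i(p_{it}^{S\vee})$, $e_{it}^{S\wedge}=\kappa_i^Se_{i(t-1)}^{S\wedge}-F_i(p_{it}^{S\wedge})$, $e_{it}^{S\vee},e_{it}^{S\wedge}\in[\underline E_i^S,\overline E_i^S]$ for all $i\in S_S$, $t\in S_T$. **Models under convex ESS constraints.** *Two-Stage* and *Multistage*: replace $p_t^S$ by $(p_t^{SD},p_t^{SC})$ and $(\mathrm{OC}_t)$ by $(\mathrm{OC}'_t)$. *Outer* and *Single-ESS*: replace each ESS power variable (those with superscript $S\vee$, $S\wedge$, respectively $S\star\bullet$) by a pair of discharging and charging powers with the same marks, $C_t$ by $C_t'$, and each term $F_i(\cdot)$ by (discharging power)$\,\tau/\eta_i^{SD}-$(charging power)$\,\tau\eta_i^{SC}$. *Rectangular*: make the same replacements, and let $e_{t-1}^S$ range over the vertex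 set $\prod_{i\in S_S}\{e_{i(t-1)}^{S\downarrow},e_{i(t-1)}^{S\uparrow}\}$. *Envelope*: the model displayed above, with the power envelopes $p^{S\downarrow},p^{S\uparrow}$ and the functions $F_i$, unchanged. *Enumeration* (convex ESS constraints): there exist functions $e_t^S(\cdot),p_t^{SD}(\cdot),p_t^{SC}(\cdot),y_t(\cdot)$ of $p_{\le t}^A=(p_1^A,\dots,p_t^A)\in\prod_{s\le t}\{p_s^{A\vee},p_s^{A\wedge}\}$, $t\in S_T$, such that for every $p^A\in\prod_{t\in S_T}\{p_t^{A\vee},p_t^{A\wedge}\}$ the values $e_t^S(p_{\le t}^A),p_t^{SD}(p_{\le t}^A),p_t^{SC}(p_{\le t}^A),y_t(p_{\le t}^A)$ satisfy $(\mathrm{OC}'_t)$ for all $t\in S_T$. **Reading of the items.** Items (i), (iii) and (iv) are asserted both when the models are those under general ESS constraints and when they are those under convex ESS constraints (Enumeration, which exists only under convex ESS constraints, is the same in both readings of (iv)). In item (ii) all models are those under convex ESS constraints. *)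

theory Defs
  imports "HOL-Analysis.Analysis"
begin

(* The finite node set is the finite type 'n.  ESS quantities (p^S, e^S, ...) are vectors over all
   nodes; powers of absent devices are forced to be 0, while entries of energy vectors at nodes
   without an ESS occur in no constraint. *)

record ('n::finite) dsystem =
  horizon :: nat
  tau :: real
  node1 :: 'n
  loads :: "'n set"
  gens :: "'n set"
  ess :: "'n set"
  PD_lo :: "'n \<Rightarrow> nat \<Rightarrow> real"
  PD_up :: "'n \<Rightarrow> nat \<Rightarrow> real"
  etaD :: "'n \<Rightarrow> nat \<Rightarrow> real"
  PG_lo :: "'n \<Rightarrow> nat \<Rightarrow> real"
  PG_up :: "'n \<Rightarrow> nat \<Rightarrow> real"
  SG_up :: "'n \<Rightarrow> nat \<Rightarrow> real"
  SS_up :: "'n \<Rightarrow> real"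
  E_lo :: "'n \<Rightarrow> real"
  E_up :: "'n \<Rightarrow> real"
  PSD_up :: "'n \<Rightarrow> real"
  PSC_up :: "'n \<Rightarrow> real"
  kappa :: "'n \<Rightarrow> real"
  etaSD :: "'n \<Rightarrow> real"
  etaSC :: "'n \<Rightarrow> real"
  CN :: "((real^'n) \<times> (real^'n)) set"
  e_init :: "real^'n"

(* y_t = (p^D, q^D, p^G, q^G, q^S, p^N, q^N) *)
type_synonym 'n yvec =
  "(real^'n) \<times> (real^'n) \<times> (real^'n) \<times> (real^'n) \<times> (real^'n) \<times> (real^'n) \<times> (real^'n)"

type_synonym profile = "nat \<Rightarrow> real"

definition periods :: "'n::finite dsystem \<Rightarrow> nat set" where
  "periods S = {1..horizon S}"

(* The constraints common to C_t and C'_t. *)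
fun network_ok :: "'n::finite dsystem \<Rightarrow> nat \<Rightarrow> real \<Rightarrow> real^'n \<Rightarrow> 'n yvec \<Rightarrow> bool" where
  "network_ok S t pA pS (pD, qD, pG, qG, qS, pN, qN) \<longleftrightarrow>
     (\<forall>i\<in>loads S. PD_lo S i t \<le> pD $ i \<and> pD $ i \<le> PD_up S i t \<and> qD $ i = etaD S i t * pD $ i) \<and>
     (\<forall>i. i \<notin> loads S \<longrightarrow> pD $ i = 0 \<and> qD $ i = 0) \<and>
     (\<forall>i\<in>gens S. PG_lo S i t \<le> pG $ i \<and> pG $ i \<le> PG_up S i t \<and>
        (pG $ i)\<^sup>2 + (qG $ i)\<^sup>2 \<le> (SG_up S i t)\<^sup>2) \<and>
     (\<forall>i. i \<notin> gens S \<longrightarrow> pG $ i = 0 \<and> qG $ i = 0) \<and>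
     (\<forall>i\<in>ess S. (pS $ i)\<^sup>2 + (qS $ i)\<^sup>2 \<le> (SS_up S i)\<^sup>2) \<and>
     (\<forall>i. i \<notin> ess S \<longrightarrow> pS $ i = 0 \<and> qS $ i = 0) \<and>
     (\<forall>i. pN $ i = pG $ i + pS $ i - pD $ i) \<and>
     (\<forall>i. qN $ i = qG $ i + qS $ i - qD $ i) \<and>
     pA = pN $ node1 S \<and>
     (pN, qN) \<in> CN S"

definition Cgen :: "'n::finite dsystem \<Rightarrow> nat \<Rightarrow> (real \<times> (real^'n) \<times> 'n yvec) set" where
  "Cgen S t = {(pA, pS, y). network_ok S t pA pS y \<and>
     (\<forall>i\<in>ess S. - PSC_up S i \<le> pS $ i \<and> pS $ i \<le> PSD_up S i)}"

definition Cconv ::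
    "'n::finite dsystem \<Rightarrow> nat \<Rightarrow> (real \<times> ((real^'n) \<times> (real^'n)) \<times> 'n yvec) set" where
  "Cconv S t = {(pA, (pSD, pSC), y). network_ok S t pA (pSD - pSC) y \<and>
     (\<forall>i\<in>ess S. 0 \<le> pSD $ i \<and> pSD $ i \<le> PSD_up S i \<and>
        0 \<le> pSC $ i \<and> pSC $ i \<le> PSC_up S i \<and>
        pSD $ i / PSD_up S i + pSC $ i / PSC_up S i \<le> 1) \<and>
     (\<forall>i. i \<notin> ess S \<longrightarrow> pSD $ i = 0 \<and> pSC $ i = 0)}"

definition valid_dsystem :: "'n::finite dsystem \<Rightarrow> bool" where
  "valid_dsystem S \<longleftrightarrow>
     1 \<le> horizon S \<and> 0 < tau S \<and>
     (\<forall>i\<in>ess S. 0 < PSD_up S i \<and> 0 < PSC_up S i \<and>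
        0 < kappa S i \<and> kappa S i \<le> 1 \<and>
        0 < etaSD S i \<and> etaSD S i \<le> 1 \<and>
        0 < etaSC S i \<and> etaSC S i \<le> 1 \<and>
        E_lo S i \<le> e_init S $ i \<and> e_init S $ i \<le> E_up S i) \<and>
     convex (CN S) \<and>
     (\<forall>t\<in>periods S. convex (Cgen S t) \<and> closed (Cgen S t)) \<and>
     (\<forall>t\<in>periods S. convex (Cconv S t) \<and> closed (Cconv S t))"

(* Energy drawn from ESS i in one period: F_i in the general case, its linear counterpart in
   terms of (discharging, charging) powers in the convex case. *)
definition Fgen :: "'n::finite dsystem \<Rightarrow> 'n \<Rightarrow> real^'n \<Rightarrow> real" where
  "Fgen S i p = max (p $ i) 0 * tau S / etaSD S i + min (p $ i) 0 * tau S * etaSC S i"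

definition Fconv :: "'n::finite dsystem \<Rightarrow> 'n \<Rightarrow> (real^'n) \<times> (real^'n) \<Rightarrow> real" where
  "Fconv S i = (\<lambda>(pSD, pSC). pSD $ i * tau S / etaSD S i - pSC $ i * tau S * etaSC S i)"

(* Except for Envelope and Enumeration, the models below are parametrized by the ESS constraints:
   (C, F) is (Cgen S, Fgen S) or (Cconv S, Fconv S), 'p being the type of ESS power decisions.
   Marks of variables: lo/up and the indices 1/2 stand for the vee/wedge marks, D/U for the
   down/up arrows. *)

type_synonym ('n, 'p) cset = "nat \<Rightarrow> (real \<times> 'p \<times> 'n yvec) set"
type_synonym ('n, 'p) draw = "'n \<Rightarrow> 'p \<Rightarrow> real"

definition next_energy ::
    "'n::finite dsystem \<Rightarrow> ('n, 'p) draw \<Rightarrow> real^'n \<Rightarrow> 'p \<Rightarrow> 'n \<Rightarrow> real" where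
  "next_energy S F e p i = kappa S i * e $ i - F i p"

(* e' is the stored energy at the end of the previous period. *)
definition OC ::
    "'n::finite dsystem \<Rightarrow> ('n, 'p) cset \<Rightarrow> ('n, 'p) draw \<Rightarrow>
     nat \<Rightarrow> real \<Rightarrow> real^'n \<Rightarrow> real^'n \<Rightarrow> 'p \<Rightarrow> 'n yvec \<Rightarrow> bool" where
  "OC S C F t pA e' e p y \<longleftrightarrow>
     (pA, p, y) \<in> C t \<and>
     (\<forall>i\<in>ess S. e $ i = next_energy S F e' p i \<and> E_lo S i \<le> e $ i \<and> e $ i \<le> E_up S i)"

definition two_stage ::
    "'n::finite dsystem \<Rightarrow> ('n, 'p) cset \<Rightarrow> ('n, 'p) draw \<Rightarrow> profile \<Rightarrow> profile \<Rightarrow> bool" where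
  "two_stage S C F lo up \<longleftrightarrow>
     (\<forall>pA \<in> (\<Pi>\<^sub>E t\<in>periods S. {lo t..up t}). \<exists>e p y.
        e 0 = e_init S \<and> (\<forall>t\<in>periods S. OC S C F t (pA t) (e (t - 1)) (e t) (p t) (y t)))"

(* The quantifier prefix over the last k periods; pA, e, p, y collect the values chosen before. *)
primrec multistage_from ::
    "'n::finite dsystem \<Rightarrow> ('n, 'p) cset \<Rightarrow> ('n, 'p) draw \<Rightarrow> profile \<Rightarrow> profile \<Rightarrow> nat \<Rightarrow>
     profile \<Rightarrow> (nat \<Rightarrow> real^'n) \<Rightarrow> (nat \<Rightarrow> 'p) \<Rightarrow> (nat \<Rightarrow> 'n yvec) \<Rightarrow> bool" where
  "multistage_from S C F lo up 0 pA e p y \<longleftrightarrow>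
     (\<forall>t\<in>periods S. OC S C F t (pA t) (e (t - 1)) (e t) (p t) (y t))"
| "multistage_from S C F lo up (Suc k) pA e p y \<longleftrightarrow>
     (let t = horizon S - k in
      \<forall>pA\<^sub>t \<in> {lo t..up t}. \<exists>e\<^sub>t p\<^sub>t y\<^sub>t.
        multistage_from S C F lo up k (pA(t := pA\<^sub>t)) (e(t := e\<^sub>t)) (p(t := p\<^sub>t)) (y(t := y\<^sub>t)))"

(* All initial values except e 0 are overwritten by the prefix. *)
definition multistage ::
    "'n::finite dsystem \<Rightarrow> ('n, 'p) cset \<Rightarrow> ('n, 'p) draw \<Rightarrow> profile \<Rightarrow> profile \<Rightarrow> bool" where
  "multistage S C F lo up \<longleftrightarrow>
     multistage_from S C F lo up (horizon S) undefined (\<lambda>_. e_init S) undefined undefined"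

definition ebox :: "'n::finite dsystem \<Rightarrow> real^'n \<Rightarrow> real^'n \<Rightarrow> (real^'n) set" where
  "ebox S eD eU = {e. \<forall>i\<in>ess S. e $ i \<in> {eD $ i..eU $ i}}"

definition evertices :: "'n::finite dsystem \<Rightarrow> real^'n \<Rightarrow> real^'n \<Rightarrow> (real^'n) set" where
  "evertices S eD eU = {e. \<forall>i\<in>ess S. e $ i \<in> {eD $ i, eU $ i}}"

definition energy_bounds :: "'n::finite dsystem \<Rightarrow> (nat \<Rightarrow> real^'n) \<Rightarrow> (nat \<Rightarrow> real^'n) \<Rightarrow> bool" where
  "energy_bounds S eD eU \<longleftrightarrow>
     (\<forall>i\<in>ess S. eD 0 $ i \<le> e_init S $ i \<and> e_init S $ i \<le> eU 0 $ i) \<and>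
     (\<forall>t\<in>{0..horizon S}. \<forall>i\<in>ess S.
        E_lo S i \<le> eD t $ i \<and> eD t $ i \<le> eU t $ i \<and> eU t $ i \<le> E_up S i)"

(* R is the range of the initial energies of a period: ebox S or evertices S. *)
definition rectangular ::
    "'n::finite dsystem \<Rightarrow> (real^'n \<Rightarrow> real^'n \<Rightarrow> (real^'n) set) \<Rightarrow>
     ('n, 'p) cset \<Rightarrow> ('n, 'p) draw \<Rightarrow> profile \<Rightarrow> profile \<Rightarrow> bool" where
  "rectangular S R C F lo up \<longleftrightarrow>
     (\<exists>eD eU. energy_bounds S eD eU \<and>
        (\<forall>t\<in>periods S. \<forall>e \<in> R (eD (t - 1)) (eU (t - 1)).
           \<exists>e\<^sub>1 p\<^sub>1 y\<^sub>1 e\<^sub>2 p\<^sub>2 y\<^sub>2.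
             (lo t, p\<^sub>1, y\<^sub>1) \<in> C t \<and> (up t, p\<^sub>2, y\<^sub>2) \<in> C t \<and>
             (\<forall>i\<in>ess S. e\<^sub>1 $ i \<in> {eD t $ i..eU t $ i} \<and> e\<^sub>2 $ i \<in> {eD t $ i..eU t $ i} \<and>
                e\<^sub>1 $ i = next_energy S F e p\<^sub>1 i \<and> e\<^sub>2 $ i = next_energy S F e p\<^sub>2 i)))"

definition single_step ::
    "'n::finite dsystem \<Rightarrow> ('n, 'p) cset \<Rightarrow> ('n, 'p) draw \<Rightarrow> real^'n \<Rightarrow> real^'n \<Rightarrow>
     nat \<Rightarrow> real \<Rightarrow> real^'n \<Rightarrow> 'p \<Rightarrow> 'n yvec \<Rightarrow> bool" where
  "single_step S C F eD eU t pA e p y \<longleftrightarrow>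
     (pA, p, y) \<in> C t \<and>
     (\<forall>i\<in>ess S. eD $ i \<le> next_energy S F e p i \<and> next_energy S F e p i \<le> eU $ i)"

(* Intended for systems with exactly one ESS; the index i just ranges over the singleton ess S. *)
definition single_ess ::
    "'n::finite dsystem \<Rightarrow> ('n, 'p) cset \<Rightarrow> ('n, 'p) draw \<Rightarrow> profile \<Rightarrow> profile \<Rightarrow> bool" where
  "single_ess S C F lo up \<longleftrightarrow>
     (\<exists>eD eU p\<^sub>1\<^sub>D y\<^sub>1\<^sub>D p\<^sub>1\<^sub>U y\<^sub>1\<^sub>U p\<^sub>2\<^sub>D y\<^sub>2\<^sub>D p\<^sub>2\<^sub>U y\<^sub>2\<^sub>U. energy_bounds S eD eU \<and>
        (\<forall>t\<in>periods S.
           single_step S C F (eD t) (eU t) t (lo t) (eD (t - 1)) (p\<^sub>1\<^sub>D t) (y\<^sub>1\<^sub>D t) \<and>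
           single_step S C F (eD t) (eU t) t (lo t) (eU (t - 1)) (p\<^sub>1\<^sub>U t) (y\<^sub>1\<^sub>U t) \<and>
           single_step S C F (eD t) (eU t) t (up t) (eD (t - 1)) (p\<^sub>2\<^sub>D t) (y\<^sub>2\<^sub>D t) \<and>
           single_step S C F (eD t) (eU t) t (up t) (eU (t - 1)) (p\<^sub>2\<^sub>U t) (y\<^sub>2\<^sub>U t)))"

definition envelope :: "'n::finite dsystem \<Rightarrow> profile \<Rightarrow> profile \<Rightarrow> bool" where
  "envelope S lo up \<longleftrightarrow>
     (\<exists>p\<^sub>1 y\<^sub>1 p\<^sub>2 y\<^sub>2 pD pU eD eU.
        eD 0 = e_init S \<and> eU 0 = e_init S \<and>
        (\<forall>t\<in>periods S.
           (lo t, p\<^sub>1 t, y\<^sub>1 t) \<in> Cgen S t \<and> (up t, p\<^sub>2 t, y\<^sub>2 t) \<in> Cgen S t \<and>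
           (\<forall>i\<in>ess S.
              eU t $ i = next_energy S (Fgen S) (eU (t - 1)) (pD t) i \<and>
              eD t $ i = next_energy S (Fgen S) (eD (t - 1)) (pU t) i \<and>
              pD t $ i \<le> p\<^sub>1 t $ i \<and> p\<^sub>1 t $ i \<le> pU t $ i \<and>
              pD t $ i \<le> p\<^sub>2 t $ i \<and> p\<^sub>2 t $ i \<le> pU t $ i \<and>
              eD t $ i \<in> {E_lo S i..E_up S i} \<and> eU t $ i \<in> {E_lo S i..E_up S i})))"

definition outer ::
    "'n::finite dsystem \<Rightarrow> ('n, 'p) cset \<Rightarrow> ('n, 'p) draw \<Rightarrow> profile \<Rightarrow> profile \<Rightarrow> bool" where
  "outer S C F lo up \<longleftrightarrow>
     (\<exists>p\<^sub>1 y\<^sub>1 p\<^sub>2 y\<^sub>2 e\<^sub>1 e\<^sub>2.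
        e\<^sub>1 0 = e_init S \<and> e\<^sub>2 0 = e_init S \<and>
        (\<forall>t\<in>periods S.
           (lo t, p\<^sub>1 t, y\<^sub>1 t) \<in> C t \<and> (up t, p\<^sub>2 t, y\<^sub>2 t) \<in> C t \<and>
           (\<forall>i\<in>ess S.
              e\<^sub>1 t $ i = next_energy S F (e\<^sub>1 (t - 1)) (p\<^sub>1 t) i \<and>
              e\<^sub>2 t $ i = next_energy S F (e\<^sub>2 (t - 1)) (p\<^sub>2 t) i \<and>
              e\<^sub>1 t $ i \<in> {E_lo S i..E_up S i} \<and> e\<^sub>2 t $ i \<in> {E_lo S i..E_up S i})))"

(* The period-t decisions take the truncated profile restrict pA {1..t} as argument. *)
definition enumeration :: "'n::finite dsystem \<Rightarrow> profile \<Rightarrow> profile \<Rightarrow> bool" where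
  "enumeration S lo up \<longleftrightarrow>
     (\<exists>(e :: nat \<Rightarrow> profile \<Rightarrow> real^'n)
       (p :: nat \<Rightarrow> profile \<Rightarrow> (real^'n) \<times> (real^'n))
       (y :: nat \<Rightarrow> profile \<Rightarrow> 'n yvec).
        e 0 = (\<lambda>_. e_init S) \<and>
        (\<forall>pA \<in> (\<Pi>\<^sub>E t\<in>periods S. {lo t, up t}). \<forall>t\<in>periods S.
           OC S (Cconv S) (Fconv S) t (pA t)
             (e (t - 1) (restrict pA {1..t - 1})) (e t (restrict pA {1..t}))
             (p t (restrict pA {1..t})) (y t (restrict pA {1..t}))))"

(* R^T is represented by the functions that are undefined outside {1..T}, so phi is only ever
   evaluated on R^T x R^T. The supremum over the empty set is -\<infinity> in ereal. *)
definition opt_value ::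
    "'n::finite dsystem \<Rightarrow> (profile \<times> profile \<Rightarrow> real) \<Rightarrow> (profile \<Rightarrow> profile \<Rightarrow> bool) \<Rightarrow> ereal" where
  "opt_value S \<phi> M =
     (SUP (lo, up) \<in> {(lo, up). lo \<in> periods S \<rightarrow>\<^sub>E UNIV \<and> up \<in> periods S \<rightarrow>\<^sub>E UNIV \<and>
        (\<forall>t\<in>periods S. lo t \<le> up t) \<and> M lo up}. ereal (\<phi> (lo, up)))"

definition "Envelope S \<phi> = opt_value S \<phi> (envelope S)"
definition "Enumeration S \<phi> = opt_value S \<phi> (enumeration S)"

definition "Rectangular_gen S \<phi> = opt_value S \<phi> (rectangular S (ebox S) (Cgen S) (Fgen S))"
definition "Single_ESS_gen S \<phi> = opt_value S \<phi> (single_ess S (Cgen S) (Fgen S))"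
definition "Multistage_gen S \<phi> = opt_value S \<phi> (multistage S (Cgen S) (Fgen S))"
definition "Two_Stage_gen S \<phi> = opt_value S \<phi> (two_stage S (Cgen S) (Fgen S))"
definition "Outer_gen S \<phi> = opt_value S \<phi> (outer S (Cgen S) (Fgen S))"

definition "Rectangular_conv S \<phi> = opt_value S \<phi> (rectangular S (evertices S) (Cconv S) (Fconv S))"
definition "Single_ESS_conv S \<phi> = opt_value S \<phi> (single_ess S (Cconv S) (Fconv S))"
definition "Multistage_conv S \<phi> = opt_value S \<phi> (multistage S (Cconv S) (Fconv S))"
definition "Two_Stage_conv S \<phi> = opt_value S \<phi> (two_stage S (Cconv S) (Fconv S))"
definition "Outer_conv S \<phi> = opt_value S \<phi> (outer S (Cconv S) (Fconv S))"

end

theory Submission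
  imports Defs
begin

text \<open>The multistage model is a game against the aggregate power, so it is feasible iff the initial
  energy is a winning state; the same holds for Enumeration when the adversary may only pick the
  endpoints of the intervals. Under convex constraints the winning states of the latter game form a
  convex set, hence every intermediate power is answered by mixing the answers to the endpoints. In the
  general case \<open>Fgen\<close> is only monotone, but this suffices to see that mixing two decisions
  that stay in an energy box stays in the box. With a single storage system, two extreme winning
  energies per period already span an invariant box, so no compactness is needed.\<close>

subsection \<open>Winning energy states\<close>

text \<open>As phi is arbitrary, each inequality is proved as an inclusion of feasible sets, and the
  equalities in (iii) and (iv) by closing cycles of inequalities. In the general case the energy
  balance is an equation in the nonlinear \<open>Fgen\<close>: a mixture of two decisions need not
  lead to the mixture of the two energies, so the argument behind Enumeration breaks down. A box
  only asks that the next energy, whatever its value, lie between two bounds, which is why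
  \<open>can_step\<close> prescribes an interval and no target energy. Envelope keeps the general
  constraints in both readings; it reaches the convex models by splitting a signed power into a
  discharging and a charging part with the same energy draw.\<close>

text \<open>The index counts the periods still to be played, as in \<open>multistage_from\<close>.\<close>

primrec safe ::
    "'n::finite dsystem \<Rightarrow> ('n, 'p) cset \<Rightarrow> ('n, 'p) draw \<Rightarrow> (nat \<Rightarrow> real set) \<Rightarrow>
     nat \<Rightarrow> real^'n \<Rightarrow> bool" where
  "safe S C F A 0 e \<longleftrightarrow> True"
| "safe S C F A (Suc k) e \<longleftrightarrow>
     (\<forall>a\<in>A (horizon S - k). \<exists>e' p y.
        OC S C F (horizon S - k) a e e' p y \<and> safe S C F A k e')"

lemma safe_antimono:
  assumes "safe S C F A k e" "k \<le> horizon S" "\<And>t. t \<in> periods S \<Longrightarrow> B t \<subseteq> A t"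
  shows "safe S C F B k e"
  using assms(1,2)
proof (induction k arbitrary: e)
  case (Suc k)
  have "B (horizon S - k) \<subseteq> A (horizon S - k)"
    using Suc.prems by (intro assms(3)) (auto simp: periods_def)
  moreover have "safe S C F B k e'" if "safe S C F A k e'" for e'
    using Suc.IH[OF that] Suc.prems by simp
  ultimately show ?case
    using Suc.prems(1) unfolding safe.simps by blast
qed simp

text \<open>All constraints sit under the innermost quantifier, but those of past periods do not
  mention later choices and can be pulled out. This needs nonempty intervals: an empty one would
  make the left side vacuous while the right side still asked for the past constraints.\<close>

lemma multistage_from_iff_safe:
  assumes "k \<le> horizon S" "\<forall>t\<in>periods S. lo t \<le> up t"
  shows "multistage_from S C F lo up k pA e p y \<longleftrightarrow>
    (\<forall>t\<in>{1..horizon S - k}. OC S C F t (pA t) (e (t - 1)) (e t) (p t) (y t)) \<and>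
    safe S C F (\<lambda>t. {lo t..up t}) k (e (horizon S - k))"
  using assms(1)
proof (induction k arbitrary: pA e p y)
  case 0
  then show ?case by (simp add: periods_def)
next
  case (Suc k)
  define t where "t = horizon S - k"
  have t: "t \<in> periods S" "horizon S - Suc k = t - 1" "t \<ge> 1"
    using Suc.prems by (auto simp: t_def periods_def)
  have split: "{1..t} = insert t {1..t - 1}"
    using t by auto
  have step: "(\<forall>s\<in>{1..t}. OC S C F s ((pA(t := a)) s) ((e(t := e')) (s - 1)) ((e(t := e')) s)
        ((p(t := p')) s) ((y(t := y')) s)) \<longleftrightarrow>
      OC S C F t a (e (t - 1)) e' p' y' \<and>
      (\<forall>s\<in>{1..t - 1}. OC S C F s (pA s) (e (s - 1)) (e s) (p s) (y s))" for a e' p' y'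
  proof -
    have "OC S C F s ((pA(t := a)) s) ((e(t := e')) (s - 1)) ((e(t := e')) s)
        ((p(t := p')) s) ((y(t := y')) s) \<longleftrightarrow> OC S C F s (pA s) (e (s - 1)) (e s) (p s) (y s)"
      if "s \<in> {1..t - 1}" for s
    proof -
      have "s \<noteq> t" "s - 1 \<noteq> t" using that by auto
      then show ?thesis by simp
    qed
    moreover have "t - 1 \<noteq> t" using t by auto
    ultimately show ?thesis unfolding split by auto
  qed
  have ne: "{lo t..up t} \<noteq> {}"
    using assms(2) t by auto
  have "multistage_from S C F lo up (Suc k) pA e p y \<longleftrightarrow>
    (\<forall>a\<in>{lo t..up t}. \<exists>e' p' y'. (\<forall>s\<in>{1..t}. OC S C F s ((pA(t := a)) s) ((e(t := e')) (s - 1))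
        ((e(t := e')) s) ((p(t := p')) s) ((y(t := y')) s)) \<and>
        safe S C F (\<lambda>t. {lo t..up t}) k e')"
    using Suc by (simp add: Let_def flip: t_def)
  also have "\<dots> \<longleftrightarrow> (\<forall>s\<in>{1..t - 1}. OC S C F s (pA s) (e (s - 1)) (e s) (p s) (y s)) \<and>
      (\<forall>a\<in>{lo t..up t}. \<exists>e' p' y'. OC S C F t a (e (t - 1)) e' p' y' \<and>
         safe S C F (\<lambda>t. {lo t..up t}) k e')"
    unfolding step using ne by blast
  finally show ?case
    unfolding t(2) by (simp flip: t_def)
qed

lemma multistage_iff_safe:
  assumes "\<forall>t\<in>periods S. lo t \<le> up t"
  shows "multistage S C F lo up \<longleftrightarrow> safe S C F (\<lambda>t. {lo t..up t}) (horizon S) (e_init S)"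
  unfolding multistage_def by (subst multistage_from_iff_safe) (use assms in auto)

text \<open>Choosing one winning answer for every state and power yields a single non-anticipative
  policy. Two-Stage runs it along a fixed profile, and Enumeration is such a policy.\<close>

lemma safe_policy:
  assumes "safe S C F A (horizon S) e0"
  obtains e p y where "e 0 = (\<lambda>_. e0)"
    "\<And>pA t. (\<And>t. t \<in> periods S \<Longrightarrow> pA t \<in> A t) \<Longrightarrow> t \<in> periods S \<Longrightarrow>
       OC S C F t (pA t) (e (t - 1) (restrict pA {1..t - 1})) (e t (restrict pA {1..t}))
         (p t (restrict pA {1..t})) (y t (restrict pA {1..t}))"
proof -
  define g where "g t a x = (SOME z. OC S C F t a x (fst z) (fst (snd z)) (snd (snd z)) \<and>
    safe S C F A (horizon S - t) (fst z))" for t a x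
  have g: "OC S C F (Suc t) a x (fst (g (Suc t) a x)) (fst (snd (g (Suc t) a x)))
        (snd (snd (g (Suc t) a x))) \<and> safe S C F A (horizon S - Suc t) (fst (g (Suc t) a x))"
    if "t < horizon S" "safe S C F A (horizon S - t) x" "a \<in> A (Suc t)" for t a x
  proof -
    have "horizon S - t = Suc (horizon S - Suc t)" "horizon S - (horizon S - Suc t) = Suc t"
      using that by auto
    then have "\<exists>e' p y. OC S C F (Suc t) a x e' p y \<and> safe S C F A (horizon S - Suc t) e'"
      using that by simp
    then have "\<exists>z. OC S C F (Suc t) a x (fst z) (fst (snd z)) (snd (snd z)) \<and>
        safe S C F A (horizon S - Suc t) (fst z)"
      by (metis fst_conv snd_conv)
    from someI_ex[OF this] show ?thesis
      unfolding g_def .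
  qed
  \<comment> \<open>The recursion truncates the profile itself, so the energy of a period sees no
    later power.\<close>
  define e where "e = rec_nat (\<lambda>_. e0)
    (\<lambda>t r h. fst (g (Suc t) (h (Suc t)) (r (restrict h {1..t}))))"
  define p where "p t h = fst (snd (g t (h t) (e (t - 1) (restrict h {1..t - 1}))))" for t h
  define y where "y t h = snd (snd (g t (h t) (e (t - 1) (restrict h {1..t - 1}))))" for t h
  have e_Suc: "e (Suc t) (restrict h {1..Suc t}) = fst (g (Suc t) (h (Suc t)) (e t (restrict h {1..t})))"
    for t h
  proof -
    have "restrict (restrict h {1..Suc t}) {1..t} = restrict h {1..t}"
      by auto
    then show ?thesis by (simp add: e_def)
  qed
  have rr: "restrict (restrict h {1..t}) {1..t - 1} = restrict h {1..t - 1}" for h :: profile and t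
    by auto
  show ?thesis
  proof (rule that[of e p y])
    show "e 0 = (\<lambda>_. e0)" by (simp add: e_def)
    fix pA t
    assume pA: "\<And>t. t \<in> periods S \<Longrightarrow> pA t \<in> A t" and t: "t \<in> periods S"
    have safe: "s \<le> horizon S \<Longrightarrow> safe S C F A (horizon S - s) (e s (restrict pA {1..s}))" for s
    proof (induction s)
      case 0
      then show ?case using assms by (simp add: e_def)
    next
      case (Suc s)
      then have "s < horizon S" "s \<le> horizon S" "pA (Suc s) \<in> A (Suc s)"
        using pA[of "Suc s"] by (auto simp: periods_def)
      from g[OF this(1) Suc.IH[OF this(2)] this(3)] show ?case
        unfolding e_Suc by blast
    qed
    obtain s where s: "t = Suc s" "s < horizon S"
      using t by (cases t) (auto simp: periods_def)
    have "pA (Suc s) \<in> A (Suc s)"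
      using pA t s by auto
    from g[OF s(2) safe this] s(2)
    show "OC S C F t (pA t) (e (t - 1) (restrict pA {1..t - 1})) (e t (restrict pA {1..t}))
       (p t (restrict pA {1..t})) (y t (restrict pA {1..t}))"
      unfolding p_def y_def rr using s by (simp add: e_Suc del: One_nat_def)
  qed
qed

text \<open>Answers that look only at the past also answer a profile known in full.\<close>

lemma safe_imp_two_stage:
  assumes "safe S C F (\<lambda>t. {lo t..up t}) (horizon S) (e_init S)"
  shows "two_stage S C F lo up"
proof -
  obtain e p y where e: "e 0 = (\<lambda>_. e_init S)"
    and pol: "\<And>pA t. (\<And>t. t \<in> periods S \<Longrightarrow> pA t \<in> {lo t..up t}) \<Longrightarrow> t \<in> periods S \<Longrightarrow>
       OC S C F t (pA t) (e (t - 1) (restrict pA {1..t - 1})) (e t (restrict pA {1..t}))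
         (p t (restrict pA {1..t})) (y t (restrict pA {1..t}))"
    using safe_policy[OF assms] by blast
  show ?thesis
    unfolding two_stage_def
  proof
    fix pA assume "pA \<in> (\<Pi>\<^sub>E t\<in>periods S. {lo t..up t})"
    then have "\<And>t. t \<in> periods S \<Longrightarrow> pA t \<in> {lo t..up t}"
      by (rule PiE_mem)
    from pol[of pA, OF this] e
    show "\<exists>e p y. e 0 = e_init S \<and>
        (\<forall>t\<in>periods S. OC S C F t (pA t) (e (t - 1)) (e t) (p t) (y t))"
      by (intro exI[of _ "\<lambda>t. e t (restrict pA {1..t})"] exI[of _ "\<lambda>t. p t (restrict pA {1..t})"]
          exI[of _ "\<lambda>t. y t (restrict pA {1..t})"]) simp
  qed
qed

text \<open>The extreme profiles \<open>lo\<close> and \<open>up\<close> are themselves points of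
  the product of intervals; the extensionality hypotheses put them into \<open>PiE\<close>.\<close>

lemma two_stage_imp_outer:
  assumes "two_stage S C F lo up" "lo \<in> periods S \<rightarrow>\<^sub>E UNIV" "up \<in> periods S \<rightarrow>\<^sub>E UNIV"
    and "\<forall>t\<in>periods S. lo t \<le> up t"
  shows "outer S C F lo up"
proof -
  have "lo \<in> (\<Pi>\<^sub>E t\<in>periods S. {lo t..up t})" "up \<in> (\<Pi>\<^sub>E t\<in>periods S. {lo t..up t})"
    using assms(2-4) by (auto simp: PiE_iff)
  from this[THEN bspec[OF assms(1)[unfolded two_stage_def]]]
  obtain e p y e' p' y' where h: "e 0 = e_init S"
      "\<forall>t\<in>periods S. OC S C F t (lo t) (e (t - 1)) (e t) (p t) (y t)"
      "e' 0 = e_init S"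
      "\<forall>t\<in>periods S. OC S C F t (up t) (e' (t - 1)) (e' t) (p' t) (y' t)"
    by blast
  show ?thesis
    unfolding outer_def atLeastAtMost_iff
    by (rule exI[of _ p], rule exI[of _ y], rule exI[of _ p'], rule exI[of _ y'],
        rule exI[of _ e], rule exI[of _ e']) (use h[unfolded OC_def] in blast)
qed

lemma enumeration_iff_safe:
  assumes "\<forall>t\<in>periods S. lo t \<le> up t"
  shows "enumeration S lo up \<longleftrightarrow>
    safe S (Cconv S) (Fconv S) (\<lambda>t. {lo t, up t}) (horizon S) (e_init S)"
proof
  assume "enumeration S lo up"
  then obtain e p y where e: "e 0 = (\<lambda>_. e_init S)"
    and pol: "\<And>pA t. pA \<in> (\<Pi>\<^sub>E t\<in>periods S. {lo t, up t}) \<Longrightarrow> t \<in> periods S \<Longrightarrow>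
       OC S (Cconv S) (Fconv S) t (pA t) (e (t - 1) (restrict pA {1..t - 1}))
         (e t (restrict pA {1..t})) (p t (restrict pA {1..t})) (y t (restrict pA {1..t}))"
    unfolding enumeration_def by blast
  \<comment> \<open>Only states that the given policy reaches are claimed to be winning, hence the
    quantification over profiles.\<close>
  have "safe S (Cconv S) (Fconv S) (\<lambda>t. {lo t, up t}) k
      (e (horizon S - k) (restrict pA {1..horizon S - k}))"
    if "k \<le> horizon S" "pA \<in> (\<Pi>\<^sub>E t\<in>periods S. {lo t, up t})" for k pA
    using that
  proof (induction k arbitrary: pA)
    case (Suc k)
    define t where "t = horizon S - k"
    have t: "t \<in> periods S" "horizon S - Suc k = t - 1" "t \<ge> 1"
      using Suc.prems by (auto simp: t_def periods_def)
    show ?case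
      unfolding safe.simps t(2) t_def[symmetric]
    proof
      fix a assume "a \<in> {lo t, up t}"
      then have upd: "pA(t := a) \<in> (\<Pi>\<^sub>E t\<in>periods S. {lo t, up t})"
        using Suc.prems t by (auto simp: PiE_iff extensional_def)
      \<comment> \<open>Changing the power of period \<open>t\<close> keeps the history, so both
        extreme powers are answered from the same energy.\<close>
      have "restrict (pA(t := a)) {1..t - 1} = restrict pA {1..t - 1}"
        using t by (auto simp: restrict_def fun_eq_iff)
      from pol[OF upd t(1), unfolded this fun_upd_same]
        Suc.IH[OF Suc_leD[OF Suc.prems(1)] upd, folded t_def]
      show "\<exists>e' p' y'. OC S (Cconv S) (Fconv S) t a (e (t - 1) (restrict pA {1..t - 1})) e' p' y' \<and>
          safe S (Cconv S) (Fconv S) (\<lambda>t. {lo t, up t}) k e'"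
        by blast
    qed
  qed simp
  from this[of "horizon S" "restrict lo (periods S)"] e
  show "safe S (Cconv S) (Fconv S) (\<lambda>t. {lo t, up t}) (horizon S) (e_init S)"
    by auto
next
  assume "safe S (Cconv S) (Fconv S) (\<lambda>t. {lo t, up t}) (horizon S) (e_init S)"
  then obtain e p y where e: "e 0 = (\<lambda>_. e_init S)"
    and pol: "\<And>pA t. (\<And>t. t \<in> periods S \<Longrightarrow> pA t \<in> {lo t, up t}) \<Longrightarrow> t \<in> periods S \<Longrightarrow>
       OC S (Cconv S) (Fconv S) t (pA t) (e (t - 1) (restrict pA {1..t - 1}))
         (e t (restrict pA {1..t})) (p t (restrict pA {1..t})) (y t (restrict pA {1..t}))"
    using safe_policy[where C = "Cconv S" and F = "Fconv S"] by blast
  show "enumeration S lo up"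
    unfolding enumeration_def
  proof (intro exI conjI ballI)
    show "e 0 = (\<lambda>_. e_init S)" by (fact e)
    fix pA t
    assume "pA \<in> (\<Pi>\<^sub>E t\<in>periods S. {lo t, up t})" "t \<in> periods S"
    then show "OC S (Cconv S) (Fconv S) t (pA t) (e (t - 1) (restrict pA {1..t - 1}))
         (e t (restrict pA {1..t})) (p t (restrict pA {1..t})) (y t (restrict pA {1..t}))"
      by (intro pol) (auto dest: PiE_mem)
  qed
qed


subsection \<open>Convexity\<close>

lemma segment_real:
  fixes a l h :: real
  assumes "l \<le> a" "a \<le> h"
  obtains u v where "0 \<le> u" "0 \<le> v" "u + v = 1" "a = u * l + v * h"
proof -
  have "a \<in> closed_segment l h"
    using assms by (simp add: closed_segment_eq_real_ivl)
  then obtain v where "0 \<le> v" "v \<le> 1" "a = (1 - v) * l + v * h"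
    by (auto simp: in_segment)
  then show ?thesis
    by (intro that[of "1 - v" v]) auto
qed

lemma convex_combination_bounds:
  fixes a b l h :: real
  assumes "0 \<le> u" "0 \<le> v" "u + v = 1" "l \<le> a" "a \<le> h" "l \<le> b" "b \<le> h"
  shows "l \<le> u * a + v * b" "u * a + v * b \<le> h"
  using convexD[OF convex_real_interval(5)[of l h], of a b u v] assms by auto

lemma Fconv_linear: "Fconv S i (u *\<^sub>R p + v *\<^sub>R q) = u * Fconv S i p + v * Fconv S i q"
  by (cases p; cases q)
    (simp add: Fconv_def algebra_simps add_divide_distrib)

lemma next_energy_conv_linear:
  "next_energy S (Fconv S) (u *\<^sub>R e + v *\<^sub>R e') (u *\<^sub>R p + v *\<^sub>R q) i =
    u * next_energy S (Fconv S) e p i + v * next_energy S (Fconv S) e' q i"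
  by (simp add: next_energy_def Fconv_linear algebra_simps)

lemma Fgen_mono:
  assumes "valid_dsystem S" "i \<in> ess S" "p $ i \<le> q $ i"
  shows "Fgen S i p \<le> Fgen S i q"
proof -
  have "0 < tau S" "0 < etaSD S i" "0 < etaSC S i"
    using assms by (auto simp: valid_dsystem_def)
  then have "max (p $ i) 0 * tau S / etaSD S i \<le> max (q $ i) 0 * tau S / etaSD S i"
    "min (p $ i) 0 * tau S * etaSC S i \<le> min (q $ i) 0 * tau S * etaSC S i"
    using assms(3) by (auto intro!: divide_right_mono mult_right_mono)
  then show ?thesis by (simp add: Fgen_def)
qed

text \<open>A mixture of two powers lies between them in each component, and monotonicity carries
  this order over to the draws. The common starting energy \<open>e\<close> matters: with two
  different ones the upper bound could fail, since \<open>Fgen\<close> is convex.\<close>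

lemma next_energy_gen_between:
  assumes S: "valid_dsystem S" and i: "i \<in> ess S"
    and uv: "0 \<le> u" "0 \<le> v" "u + v = 1"
    and "l \<le> next_energy S (Fgen S) e p i" "next_energy S (Fgen S) e p i \<le> h"
    and "l \<le> next_energy S (Fgen S) e q i" "next_energy S (Fgen S) e q i \<le> h"
  shows "l \<le> next_energy S (Fgen S) e (u *\<^sub>R p + v *\<^sub>R q) i"
    "next_energy S (Fgen S) e (u *\<^sub>R p + v *\<^sub>R q) i \<le> h"
proof -
  let ?r = "u *\<^sub>R p + v *\<^sub>R q"
  have "p $ i \<le> ?r $ i \<and> ?r $ i \<le> q $ i \<or> q $ i \<le> ?r $ i \<and> ?r $ i \<le> p $ i"
    using convex_combination_bounds[OF uv, of "p $ i" "p $ i" "q $ i" "q $ i"]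
      convex_combination_bounds[OF uv, of "q $ i" "p $ i" "p $ i" "q $ i"]
    by (cases "p $ i \<le> q $ i") auto
  then have "Fgen S i p \<le> Fgen S i ?r \<and> Fgen S i ?r \<le> Fgen S i q \<or>
      Fgen S i q \<le> Fgen S i ?r \<and> Fgen S i ?r \<le> Fgen S i p"
    using Fgen_mono[OF S i] by blast
  then show "l \<le> next_energy S (Fgen S) e ?r i" "next_energy S (Fgen S) e ?r i \<le> h"
    using assms(6-) by (auto simp: next_energy_def)
qed

lemma Cconv_convex_combination:
  assumes "valid_dsystem S" "t \<in> periods S" "0 \<le> u" "0 \<le> v" "u + v = 1"
    and "(a, p, y) \<in> Cconv S t" "(a', p', y') \<in> Cconv S t"
  shows "(u * a + v * a', u *\<^sub>R p + v *\<^sub>R p', u *\<^sub>R y + v *\<^sub>R y') \<in> Cconv S t"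
proof -
  have "convex (Cconv S t)"
    using assms by (auto simp: valid_dsystem_def)
  from convexD[OF this assms(6,7,3,4,5)] show ?thesis by simp
qed

lemma Cgen_convex_combination:
  assumes "valid_dsystem S" "t \<in> periods S" "0 \<le> u" "0 \<le> v" "u + v = 1"
    and "(a, p, y) \<in> Cgen S t" "(a', p', y') \<in> Cgen S t"
  shows "(u * a + v * a', u *\<^sub>R p + v *\<^sub>R p', u *\<^sub>R y + v *\<^sub>R y') \<in> Cgen S t"
proof -
  have "convex (Cgen S t)"
    using assms by (auto simp: valid_dsystem_def)
  from convexD[OF this assms(6,7,3,4,5)] show ?thesis by simp
qed

text \<open>The draw is linear in the discharging and charging powers, so the balance equation is
  linear in old energy, new energy and decision jointly.\<close>

lemma OC_conv_convex_combination:
  assumes "valid_dsystem S" "t \<in> periods S" "0 \<le> u" "0 \<le> v" "u + v = 1"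
    and "OC S (Cconv S) (Fconv S) t a d e p y" "OC S (Cconv S) (Fconv S) t a' d' e' p' y'"
  shows "OC S (Cconv S) (Fconv S) t (u * a + v * a') (u *\<^sub>R d + v *\<^sub>R d') (u *\<^sub>R e + v *\<^sub>R e')
    (u *\<^sub>R p + v *\<^sub>R p') (u *\<^sub>R y + v *\<^sub>R y')"
  unfolding OC_def
proof (intro conjI ballI)
  show "(u * a + v * a', u *\<^sub>R p + v *\<^sub>R p', u *\<^sub>R y + v *\<^sub>R y') \<in> Cconv S t"
    using assms by (intro Cconv_convex_combination) (auto simp: OC_def)
  fix i assume i: "i \<in> ess S"
  show "(u *\<^sub>R e + v *\<^sub>R e') $ i =
      next_energy S (Fconv S) (u *\<^sub>R d + v *\<^sub>R d') (u *\<^sub>R p + v *\<^sub>R p') i"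
    using assms(6,7) i by (simp add: OC_def next_energy_conv_linear)
  have "E_lo S i \<le> e $ i" "e $ i \<le> E_up S i" "E_lo S i \<le> e' $ i" "e' $ i \<le> E_up S i"
    using assms(6,7) i unfolding OC_def by blast+
  from convex_combination_bounds[OF assms(3-5) this]
  show "E_lo S i \<le> (u *\<^sub>R e + v *\<^sub>R e') $ i" "(u *\<^sub>R e + v *\<^sub>R e') $ i \<le> E_up S i"
    by simp_all
qed

text \<open>Two winning states answer the same power \<open>a\<close>; mixing the answers gives
  \<open>a\<close> back, and the next states mix into a winning state by induction.\<close>

lemma convex_safe_conv:
  assumes S: "valid_dsystem S" and "k \<le> horizon S"
  shows "convex {e. safe S (Cconv S) (Fconv S) (\<lambda>t. {lo t, up t}) k e}"
  using assms(2)
proof (induction k)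
  case 0
  then show ?case by simp
next
  case (Suc k)
  define t where "t = horizon S - k"
  have t: "t \<in> periods S"
    using Suc.prems by (auto simp: t_def periods_def)
  let ?safe = "safe S (Cconv S) (Fconv S) (\<lambda>t. {lo t, up t})"
  show ?case
  proof (rule convexI)
    fix d d' and u v :: real
    assume d: "d \<in> {e. ?safe (Suc k) e}" and d': "d' \<in> {e. ?safe (Suc k) e}"
      and uv: "0 \<le> u" "0 \<le> v" "u + v = 1"
    have "\<exists>e p y. OC S (Cconv S) (Fconv S) t a (u *\<^sub>R d + v *\<^sub>R d') e p y \<and> ?safe k e"
      if a: "a \<in> {lo t, up t}" for a
    proof -
      obtain e p y e' p' y' where
        1: "OC S (Cconv S) (Fconv S) t a d e p y" "OC S (Cconv S) (Fconv S) t a d' e' p' y'" and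
        2: "?safe k e" "?safe k e'"
        using bspec[OF d[unfolded mem_Collect_eq safe.simps t_def[symmetric]] a]
          bspec[OF d'[unfolded mem_Collect_eq safe.simps t_def[symmetric]] a] by blast
      have "u * a + v * a = a"
        using uv by (metis distrib_right mult_1)
      note OC_conv_convex_combination[OF S t uv 1, unfolded this]
      moreover have "?safe k (u *\<^sub>R e + v *\<^sub>R e')"
        using convexD[OF Suc.IH _ _ uv, of e e'] 2 Suc.prems by simp
      ultimately show ?thesis by blast
    qed
    then show "u *\<^sub>R d + v *\<^sub>R d' \<in> {e. ?safe (Suc k) e}"
      unfolding mem_Collect_eq safe.simps t_def[symmetric] by blast
  qed
qed

text \<open>The answer to an inner power mixes the answers to both endpoints from the same state. It
  ends in an energy that neither of them reaches in general; convexity makes this energy winning for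
  the endpoint game, and the induction hypothesis lifts it to the interval game.\<close>

lemma safe_conv_ends_imp_interval:
  assumes S: "valid_dsystem S" and "k \<le> horizon S"
    and "safe S (Cconv S) (Fconv S) (\<lambda>t. {lo t, up t}) k d"
  shows "safe S (Cconv S) (Fconv S) (\<lambda>t. {lo t..up t}) k d"
  using assms(2,3)
proof (induction k arbitrary: d)
  case 0
  then show ?case by simp
next
  case (Suc k)
  define t where "t = horizon S - k"
  have t: "t \<in> periods S"
    using Suc.prems by (auto simp: t_def periods_def)
  show ?case
    unfolding safe.simps t_def[symmetric]
  proof
    fix a assume "a \<in> {lo t..up t}"
    then obtain u v where uv: "0 \<le> u" "0 \<le> v" "u + v = 1" and a: "a = u * lo t + v * up t"
      using segment_real[of "lo t" a "up t"] by auto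
    from Suc.prems(2) obtain e p y e' p' y' where
      1: "OC S (Cconv S) (Fconv S) t (lo t) d e p y" "OC S (Cconv S) (Fconv S) t (up t) d e' p' y'"
      and 2: "safe S (Cconv S) (Fconv S) (\<lambda>t. {lo t, up t}) k e"
        "safe S (Cconv S) (Fconv S) (\<lambda>t. {lo t, up t}) k e'"
      unfolding safe.simps t_def[symmetric] by blast
    have "safe S (Cconv S) (Fconv S) (\<lambda>t. {lo t, up t}) k (u *\<^sub>R e + v *\<^sub>R e')"
      using convexD[OF convex_safe_conv[OF S, of k lo up] _ _ uv, of e e'] 2 Suc.prems by auto
    then have "safe S (Cconv S) (Fconv S) (\<lambda>t. {lo t..up t}) k (u *\<^sub>R e + v *\<^sub>R e')"
      using Suc.IH Suc.prems(1) by simp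
    moreover have "u *\<^sub>R d + v *\<^sub>R d = d"
      using uv by (metis scaleR_left.add scaleR_one)
    note OC_conv_convex_combination[OF S t uv 1, unfolded this, folded a]
    ultimately show "\<exists>e p y. OC S (Cconv S) (Fconv S) t a d e p y \<and>
        safe S (Cconv S) (Fconv S) (\<lambda>t. {lo t..up t}) k e"
      by blast
  qed
qed

lemma multistage_conv_iff_enumeration:
  assumes "valid_dsystem S" "\<forall>t\<in>periods S. lo t \<le> up t"
  shows "multistage S (Cconv S) (Fconv S) lo up \<longleftrightarrow> enumeration S lo up"
proof -
  let ?safe = "\<lambda>A. safe S (Cconv S) (Fconv S) A (horizon S) (e_init S)"
  have "?safe (\<lambda>t. {lo t, up t})" if "?safe (\<lambda>t. {lo t..up t})"
    using safe_antimono[OF that order_refl, of "\<lambda>t. {lo t, up t}"] assms(2) by simp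
  moreover have "?safe (\<lambda>t. {lo t..up t})" if "?safe (\<lambda>t. {lo t, up t})"
    using safe_conv_ends_imp_interval[OF assms(1) order_refl that] .
  ultimately show ?thesis
    using enumeration_iff_safe[OF assms(2)]
      multistage_iff_safe[OF assms(2), of "Cconv S" "Fconv S"] by blast
qed


subsection \<open>Energy boxes\<close>

definition can_step ::
    "'n::finite dsystem \<Rightarrow> ('n, 'p) cset \<Rightarrow> ('n, 'p) draw \<Rightarrow> real^'n \<Rightarrow> real^'n \<Rightarrow>
     nat \<Rightarrow> real \<Rightarrow> real^'n \<Rightarrow> bool" where
  "can_step S C F eD eU t a e \<longleftrightarrow> (\<exists>p y. single_step S C F eD eU t a e p y)"

lemma can_stepI: "single_step S C F eD eU t a e p y \<Longrightarrow> can_step S C F eD eU t a e"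
  unfolding can_step_def by (intro exI)

text \<open>The balance equations determine the next energies at storage nodes, so these variables
  can be eliminated. This gives Rectangular and Single-ESS the same shape, differing only in the
  range of initial energies.\<close>

lemma rectangular_iff:
  "rectangular S R C F lo up \<longleftrightarrow> (\<exists>eD eU. energy_bounds S eD eU \<and>
     (\<forall>t\<in>periods S. \<forall>e\<in>R (eD (t - 1)) (eU (t - 1)). \<forall>a\<in>{lo t, up t}.
        can_step S C F (eD t) (eU t) t a e))"
proof -
  have "(\<exists>e\<^sub>1 p\<^sub>1 y\<^sub>1 e\<^sub>2 p\<^sub>2 y\<^sub>2.
             (lo t, p\<^sub>1, y\<^sub>1) \<in> C t \<and> (up t, p\<^sub>2, y\<^sub>2) \<in> C t \<and>
             (\<forall>i\<in>ess S. e\<^sub>1 $ i \<in> {eD t $ i..eU t $ i} \<and> e\<^sub>2 $ i \<in> {eD t $ i..eU t $ i} \<and>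
                e\<^sub>1 $ i = next_energy S F e p\<^sub>1 i \<and> e\<^sub>2 $ i = next_energy S F e p\<^sub>2 i)) \<longleftrightarrow>
     (\<forall>a\<in>{lo t, up t}. can_step S C F (eD t) (eU t) t a e)" (is "?L \<longleftrightarrow> ?R") for t e eD eU
  proof
    assume ?L
    then show ?R by (fastforce simp: can_step_def single_step_def)
  next
    assume ?R
    then obtain p1 y1 p2 y2 where h: "single_step S C F (eD t) (eU t) t (lo t) e p1 y1"
      "single_step S C F (eD t) (eU t) t (up t) e p2 y2"
      by (auto simp: can_step_def)
    show ?L
      by (rule exI[of _ "\<chi> i. next_energy S F e p1 i"], rule exI[of _ p1], rule exI[of _ y1],
          rule exI[of _ "\<chi> i. next_energy S F e p2 i"], rule exI[of _ p2], rule exI[of _ y2])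
        (use h in \<open>simp add: single_step_def\<close>)
  qed
  then show ?thesis unfolding rectangular_def by simp
qed

lemma single_ess_iff:
  "single_ess S C F lo up \<longleftrightarrow> (\<exists>eD eU. energy_bounds S eD eU \<and>
     (\<forall>t\<in>periods S. \<forall>e\<in>{eD (t - 1), eU (t - 1)}. \<forall>a\<in>{lo t, up t}.
        can_step S C F (eD t) (eU t) t a e))" (is "?L \<longleftrightarrow> ?R")
proof
  assume ?L
  then show ?R unfolding single_ess_def can_step_def by fast
next
  assume ?R
  then obtain eD eU where b: "energy_bounds S eD eU" and
    "\<forall>t\<in>periods S. \<forall>e\<in>{eD (t - 1), eU (t - 1)}. \<forall>a\<in>{lo t, up t}.
      \<exists>p y. single_step S C F (eD t) (eU t) t a e p y"
    unfolding can_step_def by blast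
  then obtain P Y where step: "\<forall>t\<in>periods S. \<forall>e\<in>{eD (t - 1), eU (t - 1)}. \<forall>a\<in>{lo t, up t}.
      single_step S C F (eD t) (eU t) t a e (P t e a) (Y t e a)"
    by metis
  show ?L
    unfolding single_ess_def
    by (rule exI[of _ eD], rule exI[of _ eU],
        rule exI[of _ "\<lambda>t. P t (eD (t - 1)) (lo t)"], rule exI[of _ "\<lambda>t. Y t (eD (t - 1)) (lo t)"],
        rule exI[of _ "\<lambda>t. P t (eU (t - 1)) (lo t)"], rule exI[of _ "\<lambda>t. Y t (eU (t - 1)) (lo t)"],
        rule exI[of _ "\<lambda>t. P t (eD (t - 1)) (up t)"], rule exI[of _ "\<lambda>t. Y t (eD (t - 1)) (up t)"],
        rule exI[of _ "\<lambda>t. P t (eU (t - 1)) (up t)"], rule exI[of _ "\<lambda>t. Y t (eU (t - 1)) (up t)"])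
      (use b step in simp)
qed

text \<open>The boxes form an invariant tube: by backward induction every state in them is winning.
  \<open>A\<close> is kept arbitrary because the general case plays with whole intervals, the convex
  case with endpoints only.\<close>

lemma box_steps_imp_safe:
  assumes b: "energy_bounds S eD eU"
    and step: "\<And>t e a. t \<in> periods S \<Longrightarrow> e \<in> ebox S (eD (t - 1)) (eU (t - 1)) \<Longrightarrow> a \<in> A t \<Longrightarrow>
      can_step S C F (eD t) (eU t) t a e"
  shows "safe S C F A (horizon S) (e_init S)"
proof -
  have "safe S C F A k e" if "k \<le> horizon S" "e \<in> ebox S (eD (horizon S - k)) (eU (horizon S - k))"
    for k e
    using that
  proof (induction k arbitrary: e)
    case (Suc k)
    define t where "t = horizon S - k"
    have t: "t \<in> periods S" "horizon S - Suc k = t - 1"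
      using Suc.prems by (auto simp: t_def periods_def)
    show ?case
      unfolding safe.simps t_def[symmetric]
    proof
      fix a assume a: "a \<in> A t"
      obtain p y where py: "single_step S C F (eD t) (eU t) t a e p y"
        using step[OF t(1) Suc.prems(2)[unfolded t(2)] a] unfolding can_step_def by blast
      let ?e = "\<chi> i. next_energy S F e p i"
      have "?e \<in> ebox S (eD t) (eU t)"
        using py by (auto simp: single_step_def ebox_def)
      moreover have "OC S C F t a e ?e p y"
        unfolding OC_def
      proof (intro conjI ballI)
        show "(a, p, y) \<in> C t" using py by (simp add: single_step_def)
        fix i assume i: "i \<in> ess S"
        show "?e $ i = next_energy S F e p i" by simp
        have "eD t $ i \<le> ?e $ i" "?e $ i \<le> eU t $ i"
          using py i by (auto simp: single_step_def)
        moreover have "E_lo S i \<le> eD t $ i" "eU t $ i \<le> E_up S i"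
          using b t(1) i by (auto simp: energy_bounds_def periods_def)
        ultimately show "E_lo S i \<le> ?e $ i" "?e $ i \<le> E_up S i" by linarith+
      qed
      ultimately show "\<exists>e' p y. OC S C F t a e e' p y \<and> safe S C F A k e'"
        using Suc.IH[OF Suc_leD[OF Suc.prems(1)], folded t_def] by blast
    qed
  qed simp
  then show ?thesis
    using b by (auto simp: energy_bounds_def ebox_def)
qed

lemma can_step_gen_interval:
  assumes S: "valid_dsystem S" "t \<in> periods S" and "l \<le> a" "a \<le> h"
    and "can_step S (Cgen S) (Fgen S) eD eU t l e" "can_step S (Cgen S) (Fgen S) eD eU t h e"
  shows "can_step S (Cgen S) (Fgen S) eD eU t a e"
proof -
  obtain u v where uv: "0 \<le> u" "0 \<le> v" "u + v = 1" and a: "a = u * l + v * h"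
    using segment_real assms(3,4) by blast
  obtain p y p' y' where "single_step S (Cgen S) (Fgen S) eD eU t l e p y"
    "single_step S (Cgen S) (Fgen S) eD eU t h e p' y'"
    using assms(5,6) by (auto simp: can_step_def)
  note st = this[unfolded single_step_def]
  have "single_step S (Cgen S) (Fgen S) eD eU t a e (u *\<^sub>R p + v *\<^sub>R p') (u *\<^sub>R y + v *\<^sub>R y')"
    unfolding single_step_def a
    using st Cgen_convex_combination[OF S uv, of l p y h p' y']
      next_energy_gen_between[OF S(1) _ uv, of _ "eD $ _" e p "eU $ _" p'] by blast
  then show ?thesis by (rule can_stepI)
qed

lemma can_step_conv_convex_combination:
  assumes S: "valid_dsystem S" "t \<in> periods S" and uv: "0 \<le> u" "0 \<le> v" "u + v = 1"
    and "can_step S (Cconv S) (Fconv S) eD eU t a e" "can_step S (Cconv S) (Fconv S) eD eU t a' e'"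
  shows "can_step S (Cconv S) (Fconv S) eD eU t (u * a + v * a') (u *\<^sub>R e + v *\<^sub>R e')"
proof -
  obtain p y p' y' where "single_step S (Cconv S) (Fconv S) eD eU t a e p y"
    "single_step S (Cconv S) (Fconv S) eD eU t a' e' p' y'"
    using assms(6,7) by (auto simp: can_step_def)
  note st = this[unfolded single_step_def]
  have "single_step S (Cconv S) (Fconv S) eD eU t (u * a + v * a') (u *\<^sub>R e + v *\<^sub>R e')
      (u *\<^sub>R p + v *\<^sub>R p') (u *\<^sub>R y + v *\<^sub>R y')"
    unfolding single_step_def next_energy_conv_linear
    using st Cconv_convex_combination[OF S uv, of a p y a' p' y']
      convex_combination_bounds[OF uv, of "eD $ _" _ "eU $ _"] by blast
  then show ?thesis by (rule can_stepI)
qed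

lemma rectangular_gen_imp_multistage:
  assumes "valid_dsystem S" "\<forall>t\<in>periods S. lo t \<le> up t"
    and "rectangular S (ebox S) (Cgen S) (Fgen S) lo up"
  shows "multistage S (Cgen S) (Fgen S) lo up"
proof -
  from assms(3) obtain eD eU where b: "energy_bounds S eD eU"
    and step: "\<forall>t\<in>periods S. \<forall>e\<in>ebox S (eD (t - 1)) (eU (t - 1)). \<forall>a\<in>{lo t, up t}.
        can_step S (Cgen S) (Fgen S) (eD t) (eU t) t a e"
    unfolding rectangular_iff by blast
  have "safe S (Cgen S) (Fgen S) (\<lambda>t. {lo t..up t}) (horizon S) (e_init S)"
  proof (rule box_steps_imp_safe[OF b])
    fix t e a
    assume t: "t \<in> periods S" and e: "e \<in> ebox S (eD (t - 1)) (eU (t - 1))" and a: "a \<in> {lo t..up t}"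
    show "can_step S (Cgen S) (Fgen S) (eD t) (eU t) t a e"
      by (rule can_step_gen_interval[OF assms(1) t, of "lo t" a "up t"]) (use t e a step in auto)
  qed
  then show ?thesis
    using multistage_iff_safe[OF assms(2)] by blast
qed

text \<open>Coordinates are moved to the two ends of their interval one at a time; \<open>I\<close>
  collects those not yet known to be at an end. Coordinates without storage are free in both sets,
  so the vertices form a cylinder, in general not a finite set.\<close>

lemma convex_ebox_subset:
  assumes D: "convex D" and sub: "evertices S eD eU \<subseteq> D"
  shows "ebox S eD eU \<subseteq> D"
proof -
  have "e \<in> D" if "finite I" "I \<subseteq> ess S" "\<forall>i\<in>I. eD $ i \<le> e $ i \<and> e $ i \<le> eU $ i"
    "\<forall>i\<in>ess S - I. e $ i \<in> {eD $ i, eU $ i}" for I e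
    using that
  proof (induction I arbitrary: e)
    case empty
    then show ?case using sub by (auto simp: evertices_def)
  next
    case (insert j I)
    have "eD $ j \<le> e $ j" "e $ j \<le> eU $ j" using insert.prems by auto
    then obtain u v where uv: "0 \<le> u" "0 \<le> v" "u + v = 1" "e $ j = u * eD $ j + v * eU $ j"
      by (rule segment_real)
    let ?x = "\<lambda>c. \<chi> i. if i = j then c else e $ i"
    have x: "?x c \<in> D" if "c \<in> {eD $ j, eU $ j}" for c
      using insert.prems insert.hyps that by (intro insert.IH) auto
    have "e = u *\<^sub>R ?x (eD $ j) + v *\<^sub>R ?x (eU $ j)"
      using uv by (simp add: vec_eq_iff flip: distrib_right)
    then show ?case
      using convexD[OF D x x uv(1-3), of "eD $ j" "eU $ j"] by auto
  qed
  from this[of "ess S"] show ?thesis by (auto simp: ebox_def)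
qed

text \<open>Two separate mixings: over energies at a fixed extreme power, from the vertices to the
  box, and then over powers, by \<open>safe_conv_ends_imp_interval\<close>.\<close>

lemma rectangular_conv_imp_multistage:
  assumes S: "valid_dsystem S" and le: "\<forall>t\<in>periods S. lo t \<le> up t"
    and "rectangular S (evertices S) (Cconv S) (Fconv S) lo up"
  shows "multistage S (Cconv S) (Fconv S) lo up"
proof -
  from assms(3) obtain eD eU where b: "energy_bounds S eD eU"
    and step: "\<forall>t\<in>periods S. \<forall>e\<in>evertices S (eD (t - 1)) (eU (t - 1)). \<forall>a\<in>{lo t, up t}.
        can_step S (Cconv S) (Fconv S) (eD t) (eU t) t a e"
    unfolding rectangular_iff by blast
  have "safe S (Cconv S) (Fconv S) (\<lambda>t. {lo t, up t}) (horizon S) (e_init S)"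
  proof (rule box_steps_imp_safe[OF b])
    fix t e a
    assume t: "t \<in> periods S" and e: "e \<in> ebox S (eD (t - 1)) (eU (t - 1))" and a: "a \<in> {lo t, up t}"
    let ?D = "{e. can_step S (Cconv S) (Fconv S) (eD t) (eU t) t a e}"
    have "convex ?D"
      unfolding convex_def
      using can_step_conv_convex_combination[OF S t, of _ _ "eD t" "eU t" a _ a]
      by (auto simp flip: distrib_right)
    with convex_ebox_subset[of ?D] e t a step
    show "can_step S (Cconv S) (Fconv S) (eD t) (eU t) t a e" by blast
  qed
  then show ?thesis
    using safe_conv_ends_imp_interval[OF S] multistage_iff_safe[OF le] by blast
qed


subsection \<open>The envelope model\<close>

text \<open>At most one of the positive and negative parts is nonzero, so the joint capacity
  constraint reduces to one of the two power limits and the draws agree.\<close>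

lemma Cgen_to_Cconv:
  assumes S: "valid_dsystem S" and C: "(a, p, y) \<in> Cgen S t"
  defines "q \<equiv> ((\<chi> i. max (p $ i) 0), (\<chi> i. max (- p $ i) 0))"
  shows "(a, q, y) \<in> Cconv S t" "Fconv S i q = Fgen S i p"
proof -
  have pm: "fst q - snd q = p"
    by (auto simp: q_def vec_eq_iff)
  have off: "p $ i = 0" if "i \<notin> ess S" for i
    using C that by (cases y) (auto simp: Cgen_def)
  have on: "- PSC_up S i \<le> p $ i" "p $ i \<le> PSD_up S i" "0 < PSD_up S i" "0 < PSC_up S i"
    if "i \<in> ess S" for i
    using C S that by (auto simp: Cgen_def valid_dsystem_def)
  have "max (p $ i) 0 / PSD_up S i + max (- p $ i) 0 / PSC_up S i \<le> 1" if "i \<in> ess S" for i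
  proof -
    have "p $ i / PSD_up S i \<le> 1" "- p $ i / PSC_up S i \<le> 1"
      using on[OF that] by (subst divide_le_eq_1_pos; simp)+
    then show ?thesis by (auto simp: max_def)
  qed
  moreover have "max (p $ i) 0 \<le> PSD_up S i" "max (- p $ i) 0 \<le> PSC_up S i" if "i \<in> ess S" for i
    using on[OF that] by auto
  ultimately show "(a, q, y) \<in> Cconv S t"
    using C off pm by (auto simp: Cconv_def Cgen_def q_def)
  show "Fconv S i q = Fgen S i p"
    by (auto simp: q_def Fconv_def Fgen_def max_def min_def)
qed

lemma can_step_gen_imp_conv:
  assumes "valid_dsystem S" "can_step S (Cgen S) (Fgen S) eD eU t a e"
  shows "can_step S (Cconv S) (Fconv S) eD eU t a e"
proof -
  obtain p y where py: "single_step S (Cgen S) (Fgen S) eD eU t a e p y"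
    using assms(2) by (auto simp: can_step_def)
  then have "(a, p, y) \<in> Cgen S t" by (simp add: single_step_def)
  from Cgen_to_Cconv[OF assms(1) this] py show ?thesis
    unfolding can_step_def single_step_def next_energy_def by metis
qed

text \<open>The energy envelopes serve as the box, and the answers \<open>p1\<close>,
  \<open>p2\<close> do not depend on the current energy: the smallest power drives the upper
  envelope, the largest the lower one, and everything between stays between.\<close>

lemma envelope_imp_rectangular_gen:
  assumes S: "valid_dsystem S" and "envelope S lo up"
  shows "rectangular S (ebox S) (Cgen S) (Fgen S) lo up"
proof -
  from assms(2) obtain p1 y1 p2 y2 pD pU eD eU where
    init: "eD 0 = e_init S" "eU 0 = e_init S" and
    C: "\<And>t. t \<in> periods S \<Longrightarrow> (lo t, p1 t, y1 t) \<in> Cgen S t"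
      "\<And>t. t \<in> periods S \<Longrightarrow> (up t, p2 t, y2 t) \<in> Cgen S t" and
    E: "\<And>t i. t \<in> periods S \<Longrightarrow> i \<in> ess S \<Longrightarrow>
              eU t $ i = next_energy S (Fgen S) (eU (t - 1)) (pD t) i \<and>
              eD t $ i = next_energy S (Fgen S) (eD (t - 1)) (pU t) i \<and>
              pD t $ i \<le> p1 t $ i \<and> p1 t $ i \<le> pU t $ i \<and>
              pD t $ i \<le> p2 t $ i \<and> p2 t $ i \<le> pU t $ i \<and>
              eD t $ i \<in> {E_lo S i..E_up S i} \<and> eU t $ i \<in> {E_lo S i..E_up S i}"
    unfolding envelope_def by metis
  have step: "eD t $ i \<le> next_energy S (Fgen S) e p i \<and> next_energy S (Fgen S) e p i \<le> eU t $ i"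
    if "t \<in> periods S" "i \<in> ess S" "eD (t - 1) $ i \<le> e $ i" "e $ i \<le> eU (t - 1) $ i"
      "pD t $ i \<le> p $ i" "p $ i \<le> pU t $ i" for t i e p
  proof -
    have "0 \<le> kappa S i" using S that by (auto simp: valid_dsystem_def less_imp_le)
    then have "kappa S i * eD (t - 1) $ i \<le> kappa S i * e $ i"
      "kappa S i * e $ i \<le> kappa S i * eU (t - 1) $ i"
      using that by (auto intro: mult_left_mono)
    moreover have "Fgen S i (pD t) \<le> Fgen S i p" "Fgen S i p \<le> Fgen S i (pU t)"
      using that Fgen_mono[OF S] by auto
    ultimately show ?thesis
      using E[OF that(1,2)] by (simp add: next_energy_def)
  qed
  \<comment> \<open>Envelope does not postulate this order; it follows by applying
    \<open>step\<close> to the state \<open>eD t\<close> and the power \<open>p1\<close>.\<close>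
  have ord: "t \<le> horizon S \<Longrightarrow> i \<in> ess S \<Longrightarrow> eD t $ i \<le> eU t $ i" for t i
  proof (induction t)
    case (Suc t)
    then have "Suc t \<in> periods S" by (auto simp: periods_def)
    with Suc step[of "Suc t" i "eD t" "p1 (Suc t)"] E[of "Suc t" i] show ?case by auto
  qed (simp add: init)
  have "energy_bounds S eD eU"
    unfolding energy_bounds_def
  proof (intro conjI ballI)
    fix t i assume t: "t \<in> {0..horizon S}" and i: "i \<in> ess S"
    show "eD t $ i \<le> eU t $ i" using ord t i by simp
    have "t = 0 \<or> t \<in> periods S" using t by (auto simp: periods_def)
    then show "E_lo S i \<le> eD t $ i" "eU t $ i \<le> E_up S i"
      using E[of t i] init S i by (auto simp: valid_dsystem_def)
  qed (simp_all add: init)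
  moreover have "can_step S (Cgen S) (Fgen S) (eD t) (eU t) t a e"
    if t: "t \<in> periods S" and e: "e \<in> ebox S (eD (t - 1)) (eU (t - 1))" and a: "a \<in> {lo t, up t}"
    for t e a
  proof -
    have 1: "single_step S (Cgen S) (Fgen S) (eD t) (eU t) t (lo t) e (p1 t) (y1 t)"
      using t e C step E by (auto simp: single_step_def ebox_def)
    have 2: "single_step S (Cgen S) (Fgen S) (eD t) (eU t) t (up t) e (p2 t) (y2 t)"
      using t e C step E by (auto simp: single_step_def ebox_def)
    from 1 2 a show ?thesis by (auto intro: can_stepI)
  qed
  ultimately show ?thesis unfolding rectangular_iff by blast
qed

text \<open>The detour through the general model suffices, since vertices lie in the box and
  \<open>can_step\<close> transfers from general to convex constraints.\<close>

lemma envelope_imp_rectangular_conv: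
  assumes S: "valid_dsystem S" and "envelope S lo up"
  shows "rectangular S (evertices S) (Cconv S) (Fconv S) lo up"
proof -
  from envelope_imp_rectangular_gen[OF assms] obtain eD eU where
    b: "energy_bounds S eD eU" and step: "\<forall>t\<in>periods S. \<forall>e\<in>ebox S (eD (t - 1)) (eU (t - 1)).
      \<forall>a\<in>{lo t, up t}. can_step S (Cgen S) (Fgen S) (eD t) (eU t) t a e"
    unfolding rectangular_iff by blast
  have "evertices S (eD (t - 1)) (eU (t - 1)) \<subseteq> ebox S (eD (t - 1)) (eU (t - 1))"
    if "t \<in> periods S" for t
  proof -
    have "t - 1 \<in> {0..horizon S}" using that by (auto simp: periods_def)
    then have "\<forall>i\<in>ess S. eD (t - 1) $ i \<le> eU (t - 1) $ i"
      using b unfolding energy_bounds_def by blast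
    then show ?thesis by (fastforce simp: evertices_def ebox_def)
  qed
  then show ?thesis
    using b step can_step_gen_imp_conv[OF S] unfolding rectangular_iff by blast
qed

text \<open>Without storage nothing links the periods, and both models only ask for feasibility of
  the two extreme powers. This closes the cycle for (iv).\<close>

lemma outer_gen_imp_envelope:
  assumes "ess S = {}" "outer S (Cgen S) (Fgen S) lo up"
  shows "envelope S lo up"
proof -
  obtain p1 y1 p2 y2 where h:
    "\<forall>t\<in>periods S. (lo t, p1 t, y1 t) \<in> Cgen S t \<and> (up t, p2 t, y2 t) \<in> Cgen S t"
    using assms(2) unfolding outer_def by blast
  show ?thesis
    unfolding envelope_def assms(1)
    by (rule exI[of _ p1], rule exI[of _ y1], rule exI[of _ p2], rule exI[of _ y2])
      (use h in \<open>auto intro: exI[of _ "\<lambda>_. e_init S"]\<close>)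
qed

lemma outer_conv_imp_envelope:
  assumes "ess S = {}" "outer S (Cconv S) (Fconv S) lo up"
  shows "envelope S lo up"
proof -
  have C: "(a, fst p - snd p, y) \<in> Cgen S t" if "(a, p, y) \<in> Cconv S t" for a p y t
    using that assms(1) by (auto simp: Cconv_def Cgen_def)
  obtain p1 y1 p2 y2 where h:
    "\<forall>t\<in>periods S. (lo t, p1 t, y1 t) \<in> Cconv S t \<and> (up t, p2 t, y2 t) \<in> Cconv S t"
    using assms(2) unfolding outer_def by blast
  show ?thesis
    unfolding envelope_def assms(1)
    by (rule exI[of _ "\<lambda>t. fst (p1 t) - snd (p1 t)"], rule exI[of _ y1],
        rule exI[of _ "\<lambda>t. fst (p2 t) - snd (p2 t)"], rule exI[of _ y2])
      (use h C in \<open>auto intro: exI[of _ "\<lambda>_. e_init S"]\<close>)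
qed


subsection \<open>A single storage system\<close>

lemma can_step_cong:
  assumes "\<And>i. i \<in> ess S \<Longrightarrow> e $ i = e' $ i"
  shows "can_step S C F eD eU t a e \<longleftrightarrow> can_step S C F eD eU t a e'"
  using assms by (simp add: can_step_def single_step_def next_energy_def)

text \<open>A vertex agrees with one of the two bounds at \<open>i\<close>; elsewhere it may differ,
  which \<open>can_step_cong\<close> ignores.\<close>

lemma single_ess_imp_rectangular_conv:
  assumes "ess S = {i}" "single_ess S (Cconv S) (Fconv S) lo up"
  shows "rectangular S (evertices S) (Cconv S) (Fconv S) lo up"
proof -
  from assms(2) obtain eD eU where b: "energy_bounds S eD eU" and step:
    "\<forall>t\<in>periods S. \<forall>e\<in>{eD (t - 1), eU (t - 1)}. \<forall>a\<in>{lo t, up t}.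
        can_step S (Cconv S) (Fconv S) (eD t) (eU t) t a e"
    unfolding single_ess_iff by blast
  have "can_step S (Cconv S) (Fconv S) (eD t) (eU t) t a e"
    if t: "t \<in> periods S" and e: "e \<in> evertices S (eD (t - 1)) (eU (t - 1))"
      and a: "a \<in> {lo t, up t}" for t e a
  proof -
    obtain e' where e': "e' \<in> {eD (t - 1), eU (t - 1)}" "e $ i = e' $ i"
      using e assms(1) by (auto simp: evertices_def)
    have "can_step S (Cconv S) (Fconv S) (eD t) (eU t) t a e'"
      using step t a e'(1) by blast
    then show ?thesis
      by (rule can_step_cong[THEN iffD1, rotated]) (use assms(1) e'(2) in simp)
  qed
  with b show ?thesis unfolding rectangular_iff by blast
qed

lemma continuous_on_next_energy_gen:
  "continuous_on X (\<lambda>s. next_energy S (Fgen S) e ((1 - s) *\<^sub>R p + s *\<^sub>R q) i)"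
  unfolding next_energy_def Fgen_def divide_inverse
  by (intro continuous_intros continuous_on_max continuous_on_min)

text \<open>Interpolating the decisions of \<open>d\<close> and \<open>d'\<close> linearly need not stay below \<open>eU\<close>, as \<open>Fgen\<close> is
  convex but not linear. Instead, starting from \<open>e\<close>, the decision for \<open>d\<close> ends above \<open>eD\<close> and the one
  for \<open>d'\<close> below \<open>eU\<close>, so some point of the segment between them ends in between.\<close>

lemma can_step_gen_between:
  assumes S: "valid_dsystem S" "t \<in> periods S" and i: "ess S = {i}"
    and le: "eD $ i \<le> eU $ i" "d $ i \<le> e $ i" "e $ i \<le> d' $ i"
    and "can_step S (Cgen S) (Fgen S) eD eU t a d" "can_step S (Cgen S) (Fgen S) eD eU t a d'"
  shows "can_step S (Cgen S) (Fgen S) eD eU t a e"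
proof -
  obtain p y p' y' where st: "single_step S (Cgen S) (Fgen S) eD eU t a d p y"
    "single_step S (Cgen S) (Fgen S) eD eU t a d' p' y'"
    using assms(7,8) by (auto simp: can_step_def)
  define f where "f s = next_energy S (Fgen S) e ((1 - s) *\<^sub>R p + s *\<^sub>R p') i" for s
  have "0 \<le> kappa S i" using S i by (auto simp: valid_dsystem_def)
  then have "kappa S i * d $ i \<le> kappa S i * e $ i" "kappa S i * e $ i \<le> kappa S i * d' $ i"
    using le by (auto intro: mult_left_mono)
  then have f01: "eD $ i \<le> f 0" "f 1 \<le> eU $ i"
    using st i by (auto simp: f_def single_step_def next_energy_def)
  obtain s where s: "0 \<le> s" "s \<le> 1" "eD $ i \<le> f s" "f s \<le> eU $ i"
  proof (cases "f 0 \<le> eU $ i")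
    case True
    then show ?thesis using f01 that[of 0] by auto
  next
    case False
    \<comment> \<open>Here \<open>f 1\<close> is at most \<open>eU $ i\<close> and
      \<open>f 0\<close> is above it, so \<open>f\<close> attains \<open>eU $ i\<close> exactly; the
      lower bound there is \<open>eD $ i <= eU $ i\<close>.\<close>
    then have "\<exists>s\<ge>0. s \<le> 1 \<and> f s = eU $ i"
      using f01 by (intro IVT2') (auto simp: f_def intro: continuous_on_next_energy_gen)
    then show ?thesis using le that by auto
  qed
  have "(1 - s) * a + s * a = a" by (simp add: algebra_simps)
  then have "single_step S (Cgen S) (Fgen S) eD eU t a e ((1 - s) *\<^sub>R p + s *\<^sub>R p') ((1 - s) *\<^sub>R y + s *\<^sub>R y')"
    using Cgen_convex_combination[OF S, of "1 - s" s a p y a p' y'] s st i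
    by (auto simp: single_step_def f_def)
  then show ?thesis by (rule can_stepI)
qed

lemma single_ess_imp_rectangular_gen:
  assumes S: "valid_dsystem S" and i: "ess S = {i}" and "single_ess S (Cgen S) (Fgen S) lo up"
  shows "rectangular S (ebox S) (Cgen S) (Fgen S) lo up"
proof -
  from assms(3) obtain eD eU where b: "energy_bounds S eD eU" and step:
    "\<forall>t\<in>periods S. \<forall>e\<in>{eD (t - 1), eU (t - 1)}. \<forall>a\<in>{lo t, up t}.
        can_step S (Cgen S) (Fgen S) (eD t) (eU t) t a e"
    unfolding single_ess_iff by blast
  have "can_step S (Cgen S) (Fgen S) (eD t) (eU t) t a e"
    if t: "t \<in> periods S" and e: "e \<in> ebox S (eD (t - 1)) (eU (t - 1))" and a: "a \<in> {lo t, up t}"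
    for t e a
  proof (rule can_step_gen_between[OF S t i])
    show "eD t $ i \<le> eU t $ i"
      using b t i by (auto simp: energy_bounds_def periods_def)
    show "eD (t - 1) $ i \<le> e $ i" "e $ i \<le> eU (t - 1) $ i"
      using e i by (auto simp: ebox_def)
  qed (use step t a in auto)
  with b show ?thesis unfolding rectangular_iff by blast
qed

text \<open>A pair of winning states is followed by the smallest and the largest of the (at most four)
  winning states reached from it under the extreme aggregate powers.\<close>

lemma safe_imp_single_ess:
  assumes S: "valid_dsystem S" and i: "ess S = {i}"
    and safe: "safe S C F (\<lambda>t. {lo t, up t}) (horizon S) (e_init S)"
  shows "single_ess S C F lo up"
proof -
  let ?safe = "\<lambda>n. safe S C F (\<lambda>t. {lo t, up t}) (horizon S - n)"
  \<comment> \<open>Here \<open>n\<close> counts elapsed periods. The guards make both conditions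
    vacuous after the horizon, as dependent choice yields an infinite sequence.\<close>
  let ?P = "\<lambda>n (x, z). (n = 0 \<longrightarrow> x = e_init S \<and> z = e_init S) \<and> (n \<le> horizon S \<longrightarrow>
      ?safe n x \<and> ?safe n z \<and> E_lo S i \<le> x $ i \<and> x $ i \<le> z $ i \<and> z $ i \<le> E_up S i)"
  let ?Q = "\<lambda>n (x, z) (x', z'). n < horizon S \<longrightarrow> (\<forall>e\<in>{x, z}. \<forall>a\<in>{lo (Suc n), up (Suc n)}.
      can_step S C F x' z' (Suc n) a e)"
  have "\<exists>f. \<forall>n. ?P n (f n) \<and> ?Q n (f n) (f (Suc n))"
  proof (rule dependent_nat_choice)
    show "\<exists>xz. ?P 0 xz"
      using safe S i by (auto simp: valid_dsystem_def)
    fix xz n assume P: "?P n xz"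
    obtain x z where xz: "xz = (x, z)" by (cases xz)
    show "\<exists>xz'. ?P (Suc n) xz' \<and> ?Q n xz xz'"
    proof (cases "n < horizon S")
      case True
      then have n: "horizon S - n = Suc (horizon S - Suc n)" "horizon S - (horizon S - Suc n) = Suc n"
        by auto
      have "\<forall>q\<in>{x, z} \<times> {lo (Suc n), up (Suc n)}. \<exists>e'. (\<exists>p y. OC S C F (Suc n) (snd q) (fst q) e' p y) \<and>
          ?safe (Suc n) e'"
      proof
        fix q assume q: "q \<in> {x, z} \<times> {lo (Suc n), up (Suc n)}"
        then have "?safe n (fst q)"
          using P True unfolding xz by auto
        then have "\<forall>a\<in>{lo (Suc n), up (Suc n)}. \<exists>e' p y. OC S C F (Suc n) a (fst q) e' p y \<and>
            ?safe (Suc n) e'"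
          unfolding n(1) safe.simps n(2) .
        moreover have "snd q \<in> {lo (Suc n), up (Suc n)}"
          using q by (simp only: mem_Times_iff)
        ultimately show "\<exists>e'. (\<exists>p y. OC S C F (Suc n) (snd q) (fst q) e' p y) \<and> ?safe (Suc n) e'"
          by blast
      qed
      from bchoice[OF this] obtain g where "\<forall>q\<in>{x, z} \<times> {lo (Suc n), up (Suc n)}.
          (\<exists>p y. OC S C F (Suc n) (snd q) (fst q) (g q) p y) \<and> ?safe (Suc n) (g q)" ..
      note g = bspec[OF this]
      let ?G = "g ` ({x, z} \<times> {lo (Suc n), up (Suc n)})"
      have G: "finite ?G" "?G \<noteq> {}" by auto
      \<comment> \<open>The minimum over a finite set is attained, so the new bounds are winning
        states themselves and the construction can be repeated; the set of all winning energies need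
        not have extreme elements.\<close>
      define x' where "x' = arg_min_on (\<lambda>w. w $ i) ?G"
      have x': "x' \<in> ?G" "\<And>w. w \<in> ?G \<Longrightarrow> x' $ i \<le> w $ i"
        unfolding x'_def by (rule arg_min_if_finite[OF G], rule arg_min_least[OF G])
      define z' where "z' = arg_min_on (\<lambda>w. - w $ i) ?G"
      have z'_mem: "z' \<in> ?G"
        unfolding z'_def by (rule arg_min_if_finite[OF G])
      have z': "w $ i \<le> z' $ i" if "w \<in> ?G" for w
      proof -
        have "- z' $ i \<le> - w $ i"
          unfolding z'_def by (rule arg_min_least[OF G that])
        then show ?thesis by simp
      qed
      have bounds: "?safe (Suc n) w \<and> E_lo S i \<le> w $ i \<and> w $ i \<le> E_up S i" if w: "w \<in> ?G" for w
      proof -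
        obtain q where q: "q \<in> {x, z} \<times> {lo (Suc n), up (Suc n)}" "w = g q"
          using w by (rule imageE)
        from g[OF q(1)] show ?thesis
          unfolding OC_def i q(2) by blast
      qed
      have P': "?P (Suc n) (x', z')"
        using bounds[OF x'(1)] bounds[OF z'_mem] x'(2)[OF z'_mem] by simp
      have step: "can_step S C F x' z' (Suc n) a e"
        if "e \<in> {x, z}" "a \<in> {lo (Suc n), up (Suc n)}" for e a
      proof -
        have ea: "(e, a) \<in> {x, z} \<times> {lo (Suc n), up (Suc n)}" using that by auto
        from g[OF ea] obtain p y where "OC S C F (Suc n) a e (g (e, a)) p y"
          unfolding fst_conv snd_conv by blast
        with x'(2)[OF imageI[OF ea]] z'[OF imageI[OF ea]]
        have "single_step S C F x' z' (Suc n) a e p y"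
          by (simp add: OC_def single_step_def i)
        then show ?thesis by (rule can_stepI)
      qed
      have "?Q n (x, z) (x', z')"
        unfolding prod.case using step by blast
      with P' show ?thesis unfolding xz by blast
    next
      case False
      then have "?P (Suc n) xz" "?Q n xz xz"
        by (simp_all add: case_prod_beta)
      then show ?thesis by blast
    qed
  qed
  then obtain f where f: "\<forall>n. ?P n (f n) \<and> ?Q n (f n) (f (Suc n))" ..
  define eD eU where "eD n = fst (f n)" and "eU n = snd (f n)" for n
  have "energy_bounds S eD eU"
    using f by (simp add: energy_bounds_def i eD_def eU_def case_prod_beta)
  moreover have "\<forall>e\<in>{eD (t - 1), eU (t - 1)}. \<forall>a\<in>{lo t, up t}. can_step S C F (eD t) (eU t) t a e"
    if t: "t \<in> periods S" for t
  proof -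
    obtain s where s: "t = Suc s" "s < horizon S"
      using t by (cases t) (auto simp: periods_def)
    have "?Q s (f s) (f (Suc s))"
      using conjunct2[OF spec[OF f]] .
    then show ?thesis
      using s by (simp only: eD_def eU_def case_prod_beta diff_Suc_1 simp_thms)
  qed
  ultimately show ?thesis unfolding single_ess_iff by blast
qed

lemma multistage_imp_single_ess:
  assumes "valid_dsystem S" "ess S = {i}" "\<forall>t\<in>periods S. lo t \<le> up t"
    and "multistage S C F lo up"
  shows "single_ess S C F lo up"
proof -
  have "safe S C F (\<lambda>t. {lo t..up t}) (horizon S) (e_init S)"
    using multistage_iff_safe[OF assms(3)] assms(4) by blast
  from safe_antimono[OF this order_refl, of "\<lambda>t. {lo t, up t}"]
  have "safe S C F (\<lambda>t. {lo t, up t}) (horizon S) (e_init S)"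
    using assms(3) by simp
  with assms(1,2) show ?thesis by (rule safe_imp_single_ess)
qed


subsection \<open>Optimal values\<close>

lemma opt_value_mono:
  assumes "\<And>lo up. \<lbrakk>lo \<in> periods S \<rightarrow>\<^sub>E UNIV; up \<in> periods S \<rightarrow>\<^sub>E UNIV;
      \<forall>t\<in>periods S. lo t \<le> up t; M lo up\<rbrakk> \<Longrightarrow> M' lo up"
  shows "opt_value S \<phi> M \<le> opt_value S \<phi> M'"
  unfolding opt_value_def by (rule SUP_subset_mono) (use assms in auto)

lemma multistage_le_two_stage:
  "opt_value S \<phi> (multistage S C F) \<le> opt_value S \<phi> (two_stage S C F)"
  by (rule opt_value_mono) (simp add: multistage_iff_safe safe_imp_two_stage)

lemma two_stage_le_outer:
  "opt_value S \<phi> (two_stage S C F) \<le> opt_value S \<phi> (outer S C F)"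
  by (intro opt_value_mono two_stage_imp_outer)

theorem theorem1:
  fixes S :: "'n::finite dsystem"
    and \<phi> :: "(nat \<Rightarrow> real) \<times> (nat \<Rightarrow> real) \<Rightarrow> real"
  assumes "valid_dsystem S"
  shows
    "\<comment> \<open>(i), general and convex ESS constraints\<close>
     (Envelope S \<phi> \<le> Rectangular_gen S \<phi> \<and>
      Rectangular_gen S \<phi> \<le> Multistage_gen S \<phi> \<and>
      Multistage_gen S \<phi> \<le> Two_Stage_gen S \<phi> \<and>
      Two_Stage_gen S \<phi> \<le> Outer_gen S \<phi>) \<and>
     (Envelope S \<phi> \<le> Rectangular_conv S \<phi> \<and>
      Rectangular_conv S \<phi> \<le> Multistage_conv S \<phi> \<and>
      Multistage_conv S \<phi> \<le> Two_Stage_conv S \<phi> \<and>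
      Two_Stage_conv S \<phi> \<le> Outer_conv S \<phi>) \<and>
     \<comment> \<open>(ii)\<close>
     (Envelope S \<phi> \<le> Rectangular_conv S \<phi> \<and>
      Rectangular_conv S \<phi> \<le> Multistage_conv S \<phi> \<and>
      Multistage_conv S \<phi> = Enumeration S \<phi> \<and>
      Enumeration S \<phi> \<le> Two_Stage_conv S \<phi> \<and>
      Two_Stage_conv S \<phi> \<le> Outer_conv S \<phi>) \<and>
     \<comment> \<open>(iii), general and convex ESS constraints\<close>
     (card (ess S) = 1 \<longrightarrow>
       (Envelope S \<phi> \<le> Single_ESS_gen S \<phi> \<and>
        Single_ESS_gen S \<phi> = Rectangular_gen S \<phi> \<and>
        Rectangular_gen S \<phi> = Multistage_gen S \<phi> \<and>
        Multistage_gen S \<phi> \<le> Two_Stage_gen S \<phi> \<and>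
        Two_Stage_gen S \<phi> \<le> Outer_gen S \<phi>) \<and>
       (Envelope S \<phi> \<le> Single_ESS_conv S \<phi> \<and>
        Single_ESS_conv S \<phi> = Rectangular_conv S \<phi> \<and>
        Rectangular_conv S \<phi> = Multistage_conv S \<phi> \<and>
        Multistage_conv S \<phi> \<le> Two_Stage_conv S \<phi> \<and>
        Two_Stage_conv S \<phi> \<le> Outer_conv S \<phi>)) \<and>
     \<comment> \<open>(iv), general and convex ESS constraints\<close>
     (ess S = {} \<longrightarrow>
       (Envelope S \<phi> = Rectangular_gen S \<phi> \<and>
        Rectangular_gen S \<phi> = Multistage_gen S \<phi> \<and>
        Multistage_gen S \<phi> = Enumeration S \<phi> \<and>
        Enumeration S \<phi> = Two_Stage_gen S \<phi> \<and>
        Two_Stage_gen S \<phi> = Outer_gen S \<phi>) \<and>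
       (Envelope S \<phi> = Rectangular_conv S \<phi> \<and>
        Rectangular_conv S \<phi> = Multistage_conv S \<phi> \<and>
        Multistage_conv S \<phi> = Enumeration S \<phi> \<and>
        Enumeration S \<phi> = Two_Stage_conv S \<phi> \<and>
        Two_Stage_conv S \<phi> = Outer_conv S \<phi>))"
  proof -
  note S = assms
  have gen: "Envelope S \<phi> \<le> Rectangular_gen S \<phi>" "Rectangular_gen S \<phi> \<le> Multistage_gen S \<phi>"
    "Multistage_gen S \<phi> \<le> Two_Stage_gen S \<phi>" "Two_Stage_gen S \<phi> \<le> Outer_gen S \<phi>"
    unfolding Envelope_def Rectangular_gen_def Multistage_gen_def Two_Stage_gen_def Outer_gen_def
    by (rule opt_value_mono, erule envelope_imp_rectangular_gen[OF S])
      (rule opt_value_mono, erule (1) rectangular_gen_imp_multistage[OF S],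
        rule multistage_le_two_stage, rule two_stage_le_outer)
  have conv: "Envelope S \<phi> \<le> Rectangular_conv S \<phi>" "Rectangular_conv S \<phi> \<le> Multistage_conv S \<phi>"
    "Multistage_conv S \<phi> \<le> Two_Stage_conv S \<phi>" "Two_Stage_conv S \<phi> \<le> Outer_conv S \<phi>"
    unfolding Envelope_def Rectangular_conv_def Multistage_conv_def Two_Stage_conv_def Outer_conv_def
    by (rule opt_value_mono, erule envelope_imp_rectangular_conv[OF S])
      (rule opt_value_mono, erule (1) rectangular_conv_imp_multistage[OF S],
        rule multistage_le_two_stage, rule two_stage_le_outer)
  have enum: "Multistage_conv S \<phi> = Enumeration S \<phi>"
    unfolding Multistage_conv_def Enumeration_def
    by (rule antisym; rule opt_value_mono; simp add: multistage_conv_iff_enumeration[OF S])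
  have single: "Multistage_gen S \<phi> \<le> Single_ESS_gen S \<phi>" "Single_ESS_gen S \<phi> \<le> Rectangular_gen S \<phi>"
    "Multistage_conv S \<phi> \<le> Single_ESS_conv S \<phi>" "Single_ESS_conv S \<phi> \<le> Rectangular_conv S \<phi>"
    if i: "ess S = {i}" for i
    unfolding Multistage_gen_def Single_ESS_gen_def Rectangular_gen_def
      Multistage_conv_def Single_ESS_conv_def Rectangular_conv_def
    by (rule opt_value_mono, erule (1) multistage_imp_single_ess[OF S i])
      (rule opt_value_mono, erule single_ess_imp_rectangular_gen[OF S i],
        rule opt_value_mono, erule (1) multistage_imp_single_ess[OF S i],
        rule opt_value_mono, erule single_ess_imp_rectangular_conv[OF i])
  have none: "Outer_gen S \<phi> \<le> Envelope S \<phi>" "Outer_conv S \<phi> \<le> Envelope S \<phi>" if "ess S = {}"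
    unfolding Envelope_def Outer_gen_def Outer_conv_def
    by (rule opt_value_mono, erule outer_gen_imp_envelope[OF that])
      (rule opt_value_mono, erule outer_conv_imp_envelope[OF that])
  have iii: "card (ess S) = 1 \<longrightarrow>
       (Envelope S \<phi> \<le> Single_ESS_gen S \<phi> \<and>
        Single_ESS_gen S \<phi> = Rectangular_gen S \<phi> \<and>
        Rectangular_gen S \<phi> = Multistage_gen S \<phi> \<and>
        Multistage_gen S \<phi> \<le> Two_Stage_gen S \<phi> \<and>
        Two_Stage_gen S \<phi> \<le> Outer_gen S \<phi>) \<and>
       (Envelope S \<phi> \<le> Single_ESS_conv S \<phi> \<and>
        Single_ESS_conv S \<phi> = Rectangular_conv S \<phi> \<and>
        Rectangular_conv S \<phi> = Multistage_conv S \<phi> \<and>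
        Multistage_conv S \<phi> \<le> Two_Stage_conv S \<phi> \<and>
        Two_Stage_conv S \<phi> \<le> Outer_conv S \<phi>)" (is "_ \<longrightarrow> ?chains")
  proof
    assume "card (ess S) = 1"
    then obtain i where "ess S = {i}" by (rule card_1_singletonE)
    note single = single[OF this]
    \<comment> \<open>Multistage <= Single-ESS <= Rectangular <= Multistage is a cycle.\<close>
    show ?chains
      by (intro conjI) (use single gen conv in order)+
  qed
  have iv: "ess S = {} \<longrightarrow>
       (Envelope S \<phi> = Rectangular_gen S \<phi> \<and>
        Rectangular_gen S \<phi> = Multistage_gen S \<phi> \<and>
        Multistage_gen S \<phi> = Enumeration S \<phi> \<and>
        Enumeration S \<phi> = Two_Stage_gen S \<phi> \<and>
        Two_Stage_gen S \<phi> = Outer_gen S \<phi>) \<and>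
       (Envelope S \<phi> = Rectangular_conv S \<phi> \<and>
        Rectangular_conv S \<phi> = Multistage_conv S \<phi> \<and>
        Multistage_conv S \<phi> = Enumeration S \<phi> \<and>
        Enumeration S \<phi> = Two_Stage_conv S \<phi> \<and>
        Two_Stage_conv S \<phi> = Outer_conv S \<phi>)" (is "_ \<longrightarrow> ?chains")
  proof
    assume "ess S = {}"
    note none = none[OF this]
    \<comment> \<open>Enumeration becomes \<open>Multistage_conv\<close> in both readings; the
      general and the convex chain both run from Envelope to Outer and back, so all values
      coincide.\<close>
    show ?chains
      unfolding enum[symmetric] by (intro conjI) (use none gen conv in order)+
  qed
  show ?thesis
    by (intro conjI gen conv conv(3)[unfolded enum] enum iii iv)
qed

end
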